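(* The sequence $\{g_n\}_{n\in\mathbb{N}}$ possesses a unique accumulation point in $(C([0,1]),\|\cdot\|_\infty)$, and therefore converges uniformly on $[0,1]$ to a limiting function $g_\infty$, which is a fixed point of the linear operator $F$, i.e. $F(g_\infty)=g_\infty$. The sequence of derivatives $\{g_n'\}_{n\in\mathbb{N}}$ converges almost everywhere on $[0,1]$ and in the $L^1([0,1])$-norm to $g_\infty'$, which is a fixed point of the linear operator $B_2$, i.e. $B_2(g_\infty')=g_\infty'$ in $L^1([0,1])$.
   Context: For $h\in C([0,1])$ (continuous real-valued functions on $[0,1]$ with the supremum norm $\|\cdot\|_\infty$) define $$F(h)(x)=\sum_{k\ge 1}2^{-k}\left(h\left(\frac{x}{x+2^k}\right)-h\left(\frac{1}{1+2^kx}\right)\right),\quad x\in[0,1];$$ the series converges uniformly and $F$ is a bounded linear operator on $C([0,1])$. The sequence $\{g_n\}_{n\in\mathbb{N}}$, $\mathbb{N}=\{0,1,2,\dots\}$, is defined by $g_0(x)=1-x$ and $g_{n+1}=F(g_n)$. For $h\in L^1([0,1])$ define $$B_2(h)(x)=\sum_{k\ge 1}\left[\left(\frac{1}{x+2^k}\right)^2 h\left(\frac{x}{x+2^k}\right)+\left(\frac{1}{1+2^kx}\right)^2 h\left(\frac{1}{1+2^kx}\right)\right];$$ the series converges in $L^1([0,1])$ and $B_2$ is a bounded linear operator $L^1([0,1])\to L^1([0,1])$. An accumulation point of a sequence is a limit (in the given norm) of some subsequence. A prime denotes the derivative; for a convex function on $[0,1]$ it exists almost everywhere and is regarded as an almost-everywhere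 defined function. *)

theory Defs
  imports "HOL-Analysis.Analysis"
begin

text \<open>
  Elements of \<open>C([0,1])\<close> and \<open>L\<^sup>1([0,1])\<close> are represented by functions \<^typ>\<open>real \<Rightarrow> real\<close> of which
  only the values on \<open>{0..1}\<close> (for \<open>L\<^sup>1\<close>: almost everywhere on \<open>{0..1}\<close>) matter. Both operators
  respect this, as \<open>x / (x + 2^k)\<close> and \<open>1 / (1 + 2^k * x)\<close> map \<open>{0..1}\<close> diffeomorphically into
  \<open>{0..1}\<close>. An almost-everywhere defined derivative on \<open>{0..1}\<close> is represented by \<^const>\<open>deriv\<close>
  together with the requirement that the function be differentiable at almost every point; at
  points of the open interval neither depends on values outside \<open>{0..1}\<close>.
  Series over \<open>k \<ge> 1\<close> are written with \<^term>\<open>Suc k\<close>.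
\<close>

definition F_term :: "(real \<Rightarrow> real) \<Rightarrow> nat \<Rightarrow> real \<Rightarrow> real" where
  "F_term h k x = (1 / 2 ^ k) * (h (x / (x + 2 ^ k)) - h (1 / (1 + 2 ^ k * x)))"

definition F :: "(real \<Rightarrow> real) \<Rightarrow> real \<Rightarrow> real" where
  "F h x = (\<Sum>k. F_term h (Suc k) x)"

primrec g :: "nat \<Rightarrow> real \<Rightarrow> real" where
  "g 0 = (\<lambda>x. 1 - x)"
| "g (Suc n) = F (g n)"

definition B2_term :: "(real \<Rightarrow> real) \<Rightarrow> nat \<Rightarrow> real \<Rightarrow> real" where
  "B2_term h k x =
     (1 / (x + 2 ^ k))\<^sup>2 * h (x / (x + 2 ^ k)) + (1 / (1 + 2 ^ k * x))\<^sup>2 * h (1 / (1 + 2 ^ k * x))"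

text \<open>
  The pointwise series below converges almost everywhere for integrable \<open>h\<close>, and its pointwise
  sum is the sum of the series in \<open>L\<^sup>1([0,1])\<close>; see \<open>B2_L1\<close>.
\<close>
definition B2 :: "(real \<Rightarrow> real) \<Rightarrow> real \<Rightarrow> real" where
  "B2 h x = (\<Sum>k. B2_term h (Suc k) x)"

definition accumulation_point_C :: "(nat \<Rightarrow> real \<Rightarrow> real) \<Rightarrow> (real \<Rightarrow> real) \<Rightarrow> bool" where
  "accumulation_point_C u l \<longleftrightarrow>
     continuous_on {0..1} l \<and>
     (\<exists>r. strict_mono r \<and> uniform_limit {0..1} (\<lambda>n. u (r n)) l sequentially)"

abbreviation L1 :: "(real \<Rightarrow> real) \<Rightarrow> bool" where
  "L1 h \<equiv> integrable (lebesgue_on {0..1}) h"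

definition tendsto_L1 :: "(nat \<Rightarrow> real \<Rightarrow> real) \<Rightarrow> (real \<Rightarrow> real) \<Rightarrow> bool" where
  "tendsto_L1 u l \<longleftrightarrow>
     (\<forall>n. L1 (u n)) \<and> L1 l \<and> (\<lambda>n. LINT x|lebesgue_on {0..1}. \<bar>u n x - l x\<bar>) \<longlonglongrightarrow> 0"

lemma args_in_unit:
  assumes "x \<in> {0..1::real}"
  shows "x / (x + 2 ^ k) \<in> {0..1}" "1 / (1 + 2 ^ k * x) \<in> {0..1}"
proof -
  have "x + 2 ^ k > 0" "1 + 2 ^ k * x > 0"
    using assms by (auto intro: add_nonneg_pos add_pos_nonneg)
  with assms show "x / (x + 2 ^ k) \<in> {0..1}" "1 / (1 + 2 ^ k * x) \<in> {0..1}"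
    by (auto simp: divide_simps)
qed

lemma F_uniform_limit:
  assumes h: "continuous_on {0..1} h"
  shows "uniform_limit {0..1} (\<lambda>n x. \<Sum>k<n. F_term h (Suc k) x) (F h) sequentially"
    and "continuous_on {0..1} (F h)"
proof -
  have "bounded (h ` {0..1})"
    using compact_continuous_image[OF h] by (intro compact_imp_bounded) simp
  then obtain M where "\<forall>x\<in>{0..1}. \<bar>h x\<bar> \<le> M"
    by (auto simp: bounded_iff)
  then have M: "\<And>x. x \<in> {0..1} \<Longrightarrow> \<bar>h x\<bar> \<le> M"
    by blast
  have bd: "norm (F_term h (Suc k) x) \<le> 2 * M * (1 / 2) ^ Suc k" if x: "x \<in> {0..1}" for k x
  proof -
    have "\<bar>h (x / (x + 2 ^ Suc k)) - h (1 / (1 + 2 ^ Suc k * x))\<bar> \<le> 2 * M"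
      using M[OF args_in_unit(1)[OF x, of "Suc k"]] M[OF args_in_unit(2)[OF x, of "Suc k"]]
      by linarith
    then have "\<bar>h (x / (x + 2 ^ Suc k)) - h (1 / (1 + 2 ^ Suc k * x))\<bar> * (1 / 2) ^ Suc k
        \<le> 2 * M * (1 / 2) ^ Suc k"
      by (intro mult_right_mono) auto
    then show ?thesis
      by (simp add: F_term_def abs_mult power_one_over field_simps)
  qed
  have sm: "summable (\<lambda>k. 2 * M * (1 / 2) ^ Suc k)"
    by (intro summable_mult) (simp add: summable_geometric summable_mult)
  show *: "uniform_limit {0..1} (\<lambda>n x. \<Sum>k<n. F_term h (Suc k) x) (F h) sequentially"
    unfolding F_def[abs_def] by (rule Weierstrass_m_test[OF _ sm]) (rule bd)
  have "continuous_on {0..1} (\<lambda>x. F_term h k x)" for k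
    unfolding F_term_def
    by (intro continuous_intros continuous_on_compose2[OF h])
       (use args_in_unit[of _ k] in \<open>auto simp: image_subset_iff
          intro: add_nonneg_pos add_pos_nonneg dest: less_imp_neq\<close>,
        (smt (verit) zero_less_power mult_nonneg_nonneg)+)
  then have "continuous_on {0..1} (\<lambda>x. \<Sum>k<n. F_term h (Suc k) x)" for n
    by (intro continuous_intros)
  then show "continuous_on {0..1} (F h)"
    by (intro uniform_limit_theorem[OF _ *]) auto
qed

lemma continuous_on_g: "continuous_on {0..1} (g n)"
  by (induction n) (auto intro: F_uniform_limit continuous_intros)

lemma L1_iff: "L1 h \<longleftrightarrow> h absolutely_integrable_on {0..1}"
  by (simp add: integrable_restrict_space set_integrable_def)

lemma L1_pullback:
  fixes \<phi> :: "real \<Rightarrow> real"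
  assumes h: "L1 h"
    and der: "\<And>x. x \<in> {0..1} \<Longrightarrow> (\<phi> has_field_derivative \<phi>' x) (at x within {0..1})"
    and inj: "inj_on \<phi> {0..1}" and sub: "\<phi> ` {0..1} \<subseteq> {0..1}"
  shows "L1 (\<lambda>x. \<bar>\<phi>' x\<bar> * h (\<phi> x))"
    and "(LINT x|lebesgue_on {0..1}. \<bar>\<bar>\<phi>' x\<bar> * h (\<phi> x)\<bar>) \<le> (LINT x|lebesgue_on {0..1}. \<bar>h x\<bar>)"
proof -
  have cont: "continuous_on {0..1} \<phi>"
    using der by (meson DERIV_continuous continuous_on_eq_continuous_within)
  have meas: "\<phi> ` {0..1} \<in> sets lebesgue"
    using compact_continuous_image[OF cont] by (simp add: compact_imp_closed)
  have h1: "h absolutely_integrable_on {0..1}"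
    using h L1_iff by blast
  have ha: "(\<lambda>x. \<bar>h x\<bar>) absolutely_integrable_on {0..1}"
    using set_integrable_abs[OF h1] by simp
  have hs: "h absolutely_integrable_on \<phi> ` {0..1}"
    "(\<lambda>x. \<bar>h x\<bar>) absolutely_integrable_on \<phi> ` {0..1}"
    using set_integrable_subset[OF _ meas sub] h1 ha by auto
  have 0: "{0..1::real} \<in> sets lebesgue" by simp
  note cv = has_absolute_integral_change_of_variables_1'[OF 0 der inj]
  have 1: "(\<lambda>x. \<bar>\<phi>' x\<bar> * h (\<phi> x)) absolutely_integrable_on {0..1}"
    using cv[of h "integral (\<phi> ` {0..1}) h"] hs by simp
  then show "L1 (\<lambda>x. \<bar>\<phi>' x\<bar> * h (\<phi> x))"
    using L1_iff by blast
  have 2: "(\<lambda>x. \<bar>\<phi>' x\<bar> * \<bar>h (\<phi> x)\<bar>) absolutely_integrable_on {0..1}"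
    "integral {0..1} (\<lambda>x. \<bar>\<phi>' x\<bar> * \<bar>h (\<phi> x)\<bar>) = integral (\<phi> ` {0..1}) (\<lambda>x. \<bar>h x\<bar>)"
    using cv[of "\<lambda>x. \<bar>h x\<bar>" "integral (\<phi> ` {0..1}) (\<lambda>x. \<bar>h x\<bar>)"] hs by simp_all
  have "integral (\<phi> ` {0..1}) (\<lambda>x. \<bar>h x\<bar>) \<le> integral {0..1} (\<lambda>x. \<bar>h x\<bar>)"
    by (intro integral_subset_le sub) (use hs ha in \<open>auto simp: absolutely_integrable_on_def\<close>)
  then have "integral {0..1} (\<lambda>x. \<bar>\<phi>' x\<bar> * \<bar>h (\<phi> x)\<bar>) \<le> integral {0..1} (\<lambda>x. \<bar>h x\<bar>)"
    using 2 by simp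
  moreover have "integral {0..1} (\<lambda>x. \<bar>\<phi>' x\<bar> * \<bar>h (\<phi> x)\<bar>)
      = (LINT x|lebesgue_on {0..1}. \<bar>\<phi>' x\<bar> * \<bar>h (\<phi> x)\<bar>)"
    using 2 by (intro lebesgue_integral_eq_integral[symmetric]) (auto simp: L1_iff)
  moreover have "integral {0..1} (\<lambda>x. \<bar>h x\<bar>) = (LINT x|lebesgue_on {0..1}. \<bar>h x\<bar>)"
    using ha by (intro lebesgue_integral_eq_integral[symmetric]) (auto simp: L1_iff)
  ultimately show "(LINT x|lebesgue_on {0..1}. \<bar>\<bar>\<phi>' x\<bar> * h (\<phi> x)\<bar>)
      \<le> (LINT x|lebesgue_on {0..1}. \<bar>h x\<bar>)"
    by (simp add: abs_mult)
qed

lemma B2_term_L1: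
  assumes h: "L1 h"
  shows "L1 (B2_term h k)"
    and "(LINT x|lebesgue_on {0..1}. \<bar>B2_term h k x\<bar>)
      \<le> 2 * (LINT x|lebesgue_on {0..1}. \<bar>h x\<bar>) * (1 / 2) ^ k"
proof -
  let ?p = "\<lambda>x::real. x / (x + 2 ^ k)" and ?q = "\<lambda>x::real. 1 / (1 + 2 ^ k * x)"
  let ?p' = "\<lambda>x::real. 2 ^ k / (x + 2 ^ k)\<^sup>2" and ?q' = "\<lambda>x::real. - (2 ^ k) / (1 + 2 ^ k * x)\<^sup>2"
  have pos: "x + 2 ^ k > 0" "1 + 2 ^ k * x > 0" if "x \<in> {0..1}" for x :: real
    using that by (auto intro: add_nonneg_pos add_pos_nonneg)
  have dp: "(?p has_field_derivative ?p' x) (at x within {0..1})" if "x \<in> {0..1}" for x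
    using pos[OF that]
    by (auto intro!: derivative_eq_intros simp: power2_eq_square)
  have dq: "(?q has_field_derivative ?q' x) (at x within {0..1})" if "x \<in> {0..1}" for x
    using pos[OF that]
    by (auto intro!: derivative_eq_intros simp: power2_eq_square)
  have ip: "inj_on ?p {0..1}"
    by (rule inj_onI) (use pos in \<open>auto simp: frac_eq_eq less_imp_neq[symmetric] algebra_simps\<close>)
  have iq: "inj_on ?q {0..1}"
    by (rule inj_onI) (use pos in \<open>auto simp: frac_eq_eq less_imp_neq[symmetric] algebra_simps\<close>)
  have sp: "?p ` {0..1} \<subseteq> {0..1}" and sq: "?q ` {0..1} \<subseteq> {0..1}"
    using args_in_unit[of _ k] by blast+
  note P = L1_pullback[OF h dp ip sp] and Q = L1_pullback[OF h dq iq sq]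
  have eq: "B2_term h k = (\<lambda>x. (1 / 2) ^ k * (\<bar>?p' x\<bar> * h (?p x) + \<bar>?q' x\<bar> * h (?q x)))"
    by (rule ext) (simp add: B2_term_def algebra_simps power_one_over power_divide)
  have PQ: "L1 (\<lambda>x. \<bar>?p' x\<bar> * h (?p x) + \<bar>?q' x\<bar> * h (?q x))"
    by (intro Bochner_Integration.integrable_add P(1) Q(1))
  show "L1 (B2_term h k)"
    unfolding eq by (intro integrable_mult_right PQ)
  have "(LINT x|lebesgue_on {0..1}. \<bar>\<bar>?p' x\<bar> * h (?p x) + \<bar>?q' x\<bar> * h (?q x)\<bar>)
     \<le> (LINT x|lebesgue_on {0..1}. \<bar>\<bar>?p' x\<bar> * h (?p x)\<bar> + \<bar>\<bar>?q' x\<bar> * h (?q x)\<bar>)"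
    by (intro integral_mono integrable_abs PQ Bochner_Integration.integrable_add P(1) Q(1) abs_triangle_ineq)
  also have "\<dots> = (LINT x|lebesgue_on {0..1}. \<bar>\<bar>?p' x\<bar> * h (?p x)\<bar>)
      + (LINT x|lebesgue_on {0..1}. \<bar>\<bar>?q' x\<bar> * h (?q x)\<bar>)"
    by (intro Bochner_Integration.integral_add integrable_abs P(1) Q(1))
  also have "\<dots> \<le> 2 * (LINT x|lebesgue_on {0..1}. \<bar>h x\<bar>)"
    using P(2) Q(2) by linarith
  finally have *: "(LINT x|lebesgue_on {0..1}. \<bar>\<bar>?p' x\<bar> * h (?p x) + \<bar>?q' x\<bar> * h (?q x)\<bar>)
      \<le> 2 * (LINT x|lebesgue_on {0..1}. \<bar>h x\<bar>)" .
  have "(LINT x|lebesgue_on {0..1}. \<bar>B2_term h k x\<bar>)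
     = (1 / 2) ^ k * (LINT x|lebesgue_on {0..1}. \<bar>\<bar>?p' x\<bar> * h (?p x) + \<bar>?q' x\<bar> * h (?q x)\<bar>)"
    unfolding eq by (subst abs_mult) simp
  also have "\<dots> \<le> (1 / 2) ^ k * (2 * (LINT x|lebesgue_on {0..1}. \<bar>h x\<bar>))"
    by (intro mult_left_mono *) simp
  finally show "(LINT x|lebesgue_on {0..1}. \<bar>B2_term h k x\<bar>)
      \<le> 2 * (LINT x|lebesgue_on {0..1}. \<bar>h x\<bar>) * (1 / 2) ^ k"
    by (simp add: mult.commute mult.left_commute)
qed

lemma B2_L1:
  assumes h: "L1 h"
  shows "AE x in lebesgue_on {0..1}. (\<lambda>k. B2_term h (Suc k) x) sums B2 h x"
    and "tendsto_L1 (\<lambda>n x. \<Sum>k<n. B2_term h (Suc k) x) (B2 h)"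
proof -
  let ?M = "lebesgue_on {0..1::real}" and ?t = "\<lambda>k x. B2_term h (Suc k) x"
  note int = B2_term_L1(1)[OF h]
  have mt[measurable]: "?t k \<in> borel_measurable ?M" for k
    using int by (rule borel_measurable_integrable)
  have sum: "summable (\<lambda>k. LINT x|?M. \<bar>?t k x\<bar>)"
  proof (rule summable_comparison_test)
    show "\<exists>N. \<forall>k\<ge>N. norm (LINT x|?M. \<bar>?t k x\<bar>) \<le> 2 * (LINT x|?M. \<bar>h x\<bar>) * (1 / 2) ^ Suc k"
      using B2_term_L1(2)[OF h] by (auto simp del: power_Suc)
    show "summable (\<lambda>k. 2 * (LINT x|?M. \<bar>h x\<bar>) * (1 / 2) ^ Suc k)"
      by (intro summable_mult) (simp add: summable_geometric summable_mult)
  qed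
  have "(\<integral>\<^sup>+x. (\<Sum>k. ennreal \<bar>?t k x\<bar>) \<partial>?M) = (\<Sum>k. \<integral>\<^sup>+x. ennreal \<bar>?t k x\<bar> \<partial>?M)"
    by (intro nn_integral_suminf) measurable
  also have "\<dots> = (\<Sum>k. ennreal (LINT x|?M. \<bar>?t k x\<bar>))"
    by (intro suminf_cong nn_integral_eq_integral integrable_abs int) auto
  also have "\<dots> \<noteq> \<infinity>"
    using sum by (auto simp: ennreal_suminf_neq_top)
  finally have "AE x in ?M. (\<Sum>k. ennreal \<bar>?t k x\<bar>) \<noteq> \<infinity>"
    by (intro nn_integral_PInf_AE) measurable
  then have ae: "AE x in ?M. summable (\<lambda>k. \<bar>?t k x\<bar>)"
    by eventually_elim (auto intro: summable_suminf_not_top)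
  then show sums: "AE x in ?M. (\<lambda>k. ?t k x) sums B2 h x"
    by eventually_elim (simp add: B2_def summable_rabs_cancel summable_sums)
  have aen: "AE x in ?M. summable (\<lambda>k. norm (?t k x))"
    and sumn: "summable (\<lambda>k. LINT x|?M. norm (?t k x))"
    using ae sum by simp_all
  have B: "L1 (B2 h)"
    using integrable_suminf[OF int aen sumn] by (simp add: B2_def[abs_def])
  have dom: "L1 (\<lambda>x. \<Sum>k. \<bar>?t k x\<bar>)"
    by (rule integrable_suminf) (use int ae sum in auto)
  have S: "L1 (\<lambda>x. \<Sum>k<n. ?t k x)" for n
    by (intro Bochner_Integration.integrable_sum int)
  have "(\<lambda>n. LINT x|?M. \<bar>(\<Sum>k<n. ?t k x) - B2 h x\<bar>) \<longlonglongrightarrow> (LINT x|?M. 0)"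
  proof (rule integral_dominated_convergence)
    show "integrable ?M (\<lambda>x. (\<Sum>k. \<bar>?t k x\<bar>) + \<bar>B2 h x\<bar>)"
      by (intro Bochner_Integration.integrable_add dom integrable_abs B)
    show "AE x in ?M. (\<lambda>n. \<bar>(\<Sum>k<n. ?t k x) - B2 h x\<bar>) \<longlonglongrightarrow> 0"
      using sums
    proof eventually_elim
      case (elim x)
      then have "(\<lambda>n. (\<Sum>k<n. ?t k x) - B2 h x) \<longlonglongrightarrow> 0"
        by (simp add: sums_def LIM_zero)
      then show ?case by (simp add: tendsto_rabs_zero)
    qed
    show "AE x in ?M. norm \<bar>(\<Sum>k<n. ?t k x) - B2 h x\<bar> \<le> (\<Sum>k. \<bar>?t k x\<bar>) + \<bar>B2 h x\<bar>" for n
      using ae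
    proof eventually_elim
      case (elim x)
      have "\<bar>\<Sum>k<n. ?t k x\<bar> \<le> (\<Sum>k<n. \<bar>?t k x\<bar>)" by (rule sum_abs)
      also have "\<dots> \<le> (\<Sum>k. \<bar>?t k x\<bar>)" by (intro sum_le_suminf elim) auto
      finally show ?case by simp
    qed
  qed (use S B in \<open>auto intro!: borel_measurable_integrable Bochner_Integration.integrable_diff\<close>)
  then show "tendsto_L1 (\<lambda>n x. \<Sum>k<n. ?t k x) (B2 h)"
    using S B by (simp add: tendsto_L1_def)
qed

end

theory Submission
  imports Defs "HOL-Complex_Analysis.Great_Picard"
begin

text \<open>
  Differentiating \<open>F\<close> termwise gives \<open>F(h)' = B2(h')\<close>, and \<open>g\<^sub>0' = -1\<close>, so \<open>g\<^sub>n' = - f\<^sub>n\<close> on the open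
  interval, where \<open>f\<^sub>n\<close> is the \<open>n\<close>-th \<open>B2\<close>-iterate of the constant \<open>1\<close>. The operator \<open>B2\<close> is positive and,
  because \<open>F(H)(1) - F(H)(0) = H(1) - H(0)\<close>, preserves integrals; hence it is an \<open>L\<^sup>1\<close> contraction, a
  transfer operator. All questions about \<open>g\<^sub>n\<close> are answered by showing that \<open>f\<^sub>n\<close> converges.

  Compactness comes from an invariant cone (\<open>tame\<close>): the functions \<open>f \<ge> 0\<close> for which \<open>f x\<close>
  decreases and \<open>x\<^sup>2 * f x\<close> increases. Since \<open>g\<^sub>n\<close> drops by \<open>1\<close> on the interval, monotonicity
  gives \<open>f\<^sub>n x \<le> 1 / x\<close>; used for the branches \<open>1 / (1 + 2 ^ k * x)\<close>, this yields the
  uniform integrable bound \<open>f\<^sub>n x \<le> 4 / sqrt x\<close> (\<open>g_density_tame\<close>). The functions \<open>x\<^sup>2 * f\<^sub>n x\<close> are then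
  equi-Lipschitz and Arzela-Ascoli applies (\<open>tame_subsequence\<close>).

  Let \<open>f\<close> be a subsequential limit. The numbers \<open>\<parallel>f\<^sub>n\<^sub>+\<^sub>1 - f\<^sub>n\<parallel>\<close> decrease to a limit, and by
  continuity every iterate of \<open>d = B2 f - f\<close> has that limit as its norm. A positive operator preserves the
  norm of \<open>d\<close> only if no cancellation takes place: the values of \<open>d\<close> at all \<open>n\<close>-step preimages of
  the point \<open>1\<close> have the same weak sign. These preimages become dense as \<open>n\<close> grows, a fact
  about binary expansions (\<open>unit_preimages_dense\<close>), so \<open>d\<close> has constant sign; its integral vanishes,
  and \<open>d = 0\<close> (\<open>B2_rigid\<close>). Thus \<open>f\<close> is a fixed point, \<open>\<parallel>f\<^sub>n - f\<parallel>\<close> decreases, and it tends to zero because it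
  does so along a subsequence (\<open>g_density_converges\<close>). Integrating gives the uniform convergence of \<open>g\<^sub>n\<close>.
\<close>

section \<open>Functions with a square-root singularity\<close>

text \<open>
  Working pointwise on the half-open interval with this singularity at \<open>0\<close> turns \<open>B2\<close> into an
  everywhere convergent series; all functions of interest have such a bound, and it is
  integrable.
\<close>
definition sqrt_dominated :: "real \<Rightarrow> (real \<Rightarrow> real) \<Rightarrow> bool" where
  "sqrt_dominated C h \<longleftrightarrow> (\<forall>x\<in>{0<..1}. \<bar>h x\<bar> \<le> C / sqrt x)"

definition admissible :: "(real \<Rightarrow> real) \<Rightarrow> bool" where
  "admissible h \<longleftrightarrow> continuous_on {0<..1} h \<and> (\<exists>C. sqrt_dominated C h)"

lemma branch_in_open_unit:
  assumes "x \<in> {0<..1::real}"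
  shows "x / (x + 2 ^ k) \<in> {0<..<1}" "1 / (1 + 2 ^ k * x) \<in> {0<..<1}"
proof -
  have "x + 2 ^ k > 0" "1 + 2 ^ k * x > 0"
    using assms by (auto intro: add_nonneg_pos add_pos_nonneg)
  with assms show "x / (x + 2 ^ k) \<in> {0<..<1}" "1 / (1 + 2 ^ k * x) \<in> {0<..<1}"
    by (auto simp: divide_simps)
qed

lemma branch_in_unit:
  assumes "x \<in> {0<..1::real}"
  shows "x / (x + 2 ^ k) \<in> {0<..1}" "1 / (1 + 2 ^ k * x) \<in> {0<..1}"
  using branch_in_open_unit[OF assms, of k] by auto

text \<open>
  The branches \<open>x / (x + K)\<close> and \<open>1 / (1 + K * x)\<close>, with \<open>K = 2 ^ k\<close>, both reproduce the singularity
  \<open>1 / sqrt x\<close>, with weights summable in \<open>k\<close>. The first does so with ratio \<open>2 powr (- 3 / 2)\<close>, small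
  enough for the sum of its weights to stay below \<open>1\<close>; see \<open>tame_dominated_B2\<close>.
\<close>
lemma small_branch_weight:
  fixes x K C :: real
  assumes "x > 0" "K > 0" "C \<ge> 0"
  shows "(1 / (x + K))\<^sup>2 * (C / sqrt (x / (x + K))) \<le> C / sqrt x * (1 / (K * sqrt K))"
proof -
  have "(1 / (x + K))\<^sup>2 * (C / sqrt (x / (x + K))) = C / sqrt x * (sqrt (x + K) / (x + K)\<^sup>2)"
    using assms by (simp add: real_sqrt_divide field_simps)
  also have "sqrt (x + K) / (x + K)\<^sup>2 = 1 / ((x + K) * sqrt (x + K))"
  proof -
    have "x + K = sqrt (x + K) * sqrt (x + K)" "sqrt (x+K) > 0" using assms by auto
    then show ?thesis by (simp add: power2_eq_square divide_simps)
  qed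
  also have "C / sqrt x * (1 / ((x + K) * sqrt (x + K))) \<le> C / sqrt x * (1 / (K * sqrt K))"
    using assms by (intro mult_left_mono divide_left_mono mult_mono mult_pos_pos) auto
  finally show ?thesis .
qed

text \<open>
  The inequality of arithmetic and geometric means, applied to \<open>1\<close> and \<open>K * x\<close>.
\<close>
lemma large_branch_le:
  fixes x K :: real
  assumes "x > 0" "K > 0"
  shows "1 / (1 + K * x) \<le> 1 / sqrt x * (1 / (2 * sqrt K))"
proof -
  have "2 * sqrt (K * x) \<le> 1 + K * x"
    using assms arith_geo_mean_sqrt[of 1 "K * x"] by simp
  then have "1 / (1 + K * x) \<le> 1 / (2 * sqrt (K * x))"
    using assms by (intro divide_left_mono) (auto intro!: mult_pos_pos add_pos_pos)
  then show ?thesis using assms by (simp add: real_sqrt_mult mult_ac)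
qed

lemma large_branch_weight:
  fixes x K C :: real
  assumes "x > 0" "K > 0" "C \<ge> 0"
  shows "(1 / (1 + K * x))\<^sup>2 * (C / sqrt (1 / (1 + K * x))) \<le> C / sqrt x * (1 / (2 * sqrt K))"
proof -
  define q where "q = 1 / (1 + K * x)"
  have q: "0 < q" "q \<le> 1" using assms by (auto simp: q_def divide_simps add_pos_pos)
  have "q\<^sup>2 * (C / sqrt q) = C * (q * sqrt q)"
  proof -
    have "q = sqrt q * sqrt q" "sqrt q > 0" using q by auto
    then show ?thesis by (simp add: power2_eq_square divide_simps)
  qed
  also have "\<dots> \<le> C * (q * 1)"
    using q assms by (intro mult_left_mono) auto
  also have "\<dots> \<le> C * (1 / sqrt x * (1 / (2 * sqrt K)))"
    using large_branch_le[OF assms(1,2)] assms by (intro mult_left_mono) (auto simp: q_def)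
  finally show ?thesis by (simp add: q_def)
qed

lemma sqrt_2_power: "1 / sqrt (2 ^ k) = (1 / sqrt 2) ^ k"
  by (simp add: real_sqrt_power power_one_over)

lemma sqrt_dominated_nonneg: "sqrt_dominated C h \<Longrightarrow> C \<ge> 0"
  using abs_ge_zero[of "h 1"] unfolding sqrt_dominated_def by (auto dest!: bspec[of _ _ 1])

lemma B2_term_bound:
  assumes h: "sqrt_dominated C h" and x: "x \<in> {0<..1}"
  shows "\<bar>B2_term h (Suc k) x\<bar> \<le> C / sqrt x * (1 / sqrt 2) ^ Suc k"
proof -
  define K where "K = (2::real) ^ Suc k"
  have K: "K \<ge> 2" by (simp add: K_def)
  have C: "C \<ge> 0" using h by (rule sqrt_dominated_nonneg)
  have x0: "x > 0" using x by auto
  have br: "\<bar>h (x / (x + K))\<bar> \<le> C / sqrt (x / (x + K))"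
    "\<bar>h (1 / (1 + K * x))\<bar> \<le> C / sqrt (1 / (1 + K * x))"
    using h branch_in_unit[OF x, of "Suc k"] unfolding sqrt_dominated_def K_def by blast+
  have "\<bar>B2_term h (Suc k) x\<bar>
     \<le> (1 / (x + K))\<^sup>2 * \<bar>h (x / (x + K))\<bar> + (1 / (1 + K * x))\<^sup>2 * \<bar>h (1 / (1 + K * x))\<bar>"
    unfolding B2_term_def K_def[symmetric] by (rule order_trans[OF abs_triangle_ineq]) (simp add: abs_mult)
  also have "\<dots> \<le> C / sqrt x * (1 / (K * sqrt K)) + C / sqrt x * (1 / (2 * sqrt K))"
    using x0 K C small_branch_weight[of x K C] large_branch_weight[of x K C]
      mult_left_mono[OF br(1), of "(1 / (x + K))\<^sup>2"] mult_left_mono[OF br(2), of "(1 / (1 + K * x))\<^sup>2"]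
    by simp
  also have "\<dots> \<le> C / sqrt x * (1 / (2 * sqrt K)) + C / sqrt x * (1 / (2 * sqrt K))"
    using K C x0 by (intro add_right_mono mult_left_mono divide_left_mono mult_right_mono) auto
  also have "\<dots> = C / sqrt x * (1 / sqrt K)" by simp
  also have "1 / sqrt K = (1 / sqrt 2) ^ Suc k" unfolding K_def by (rule sqrt_2_power)
  finally show ?thesis .
qed

lemma geometric_sqrt2: "(\<lambda>k. (1 / sqrt 2) ^ Suc k) sums (1 + sqrt 2)"
proof -
  have "(\<lambda>k. (1 / sqrt 2) ^ k) sums (1 / (1 - 1 / sqrt 2))"
    by (rule geometric_sums) simp
  then have "(\<lambda>k. (1 / sqrt 2) * (1 / sqrt 2) ^ k) sums ((1 / sqrt 2) * (1 / (1 - 1 / sqrt 2)))"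
    by (rule sums_mult)
  moreover have "(1 / sqrt 2) * (1 / (1 - 1 / sqrt 2)) = 1 + sqrt 2"
  proof -
    have "sqrt 2 > 1" by simp
    then show ?thesis by (simp add: field_simps)
  qed
  ultimately show ?thesis by simp
qed

lemma summable_B2_bound: "summable (\<lambda>k. c * (1 / sqrt 2) ^ Suc k)"
  using geometric_sqrt2 by (intro summable_mult) (rule sums_summable)

lemma summable_B2_term:
  assumes "sqrt_dominated C h" "x \<in> {0<..1}"
  shows "summable (\<lambda>k. B2_term h (Suc k) x)"
  by (rule summable_comparison_test'[OF summable_B2_bound])
     (use B2_term_bound[OF assms] in \<open>simp only: real_norm_def\<close>)

lemma sqrt_dominated_B2:
  assumes "sqrt_dominated C h"
  shows "sqrt_dominated ((1 + sqrt 2) * C) (B2 h)"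
  unfolding sqrt_dominated_def
proof
  fix x :: real assume x: "x \<in> {0<..1}"
  have "norm (\<Sum>k. B2_term h (Suc k) x) \<le> (\<Sum>k. C / sqrt x * (1 / sqrt 2) ^ Suc k)"
    by (rule norm_suminf_le[OF _ summable_B2_bound])
       (use B2_term_bound[OF assms x] in \<open>simp only: real_norm_def\<close>)
  also have "\<dots> = C / sqrt x * (1 + sqrt 2)"
    using sums_mult[OF geometric_sqrt2, of "C / sqrt x"] by (rule sums_unique[symmetric])
  finally show "\<bar>B2 h x\<bar> \<le> (1 + sqrt 2) * C / sqrt x" by (simp add: B2_def mult_ac)
qed

lemma B2_uniform_limit:
  assumes h: "sqrt_dominated C h" and e: "0 < e"
  shows "uniform_limit {e..1} (\<lambda>n x. \<Sum>k<n. B2_term h (Suc k) x) (B2 h) sequentially"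
  unfolding B2_def[abs_def]
proof (rule Weierstrass_m_test[OF _ summable_B2_bound])
  fix k x assume x: "x \<in> {e..1}"
  have "\<bar>B2_term h (Suc k) x\<bar> \<le> C / sqrt x * (1 / sqrt 2) ^ Suc k"
    using x e by (intro B2_term_bound[OF h]) auto
  also have "\<dots> \<le> C / sqrt e * (1 / sqrt 2) ^ Suc k"
    using x e sqrt_dominated_nonneg[OF h]
    by (intro mult_right_mono divide_left_mono) auto
  finally show "norm (B2_term h (Suc k) x) \<le> C / sqrt e * (1 / sqrt 2) ^ Suc k" by simp
qed

lemma continuous_on_B2_term:
  assumes "continuous_on {0<..1} h"
  shows "continuous_on {0<..1} (B2_term h k)"
  unfolding B2_term_def
  by (intro continuous_intros continuous_on_compose2[OF assms])
     (use branch_in_unit[of _ k] in \<open>auto simp: image_subset_iff add_eq_0_iff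
         intro: add_pos_pos\<close>,
      (smt (verit) zero_less_power mult_pos_pos)+)

lemma admissible_B2:
  assumes "admissible h"
  shows "admissible (B2 h)"
proof -
  obtain C where h: "continuous_on {0<..1} h" "sqrt_dominated C h"
    using assms by (auto simp: admissible_def)
  have c: "continuous_on {e..1} (B2 h)" if "e > 0" for e
    by (rule uniform_limit_theorem[OF _ B2_uniform_limit[OF h(2) that]])
       (use that in \<open>auto intro!: always_eventually continuous_intros
          continuous_on_subset[OF continuous_on_B2_term[OF h(1)]]\<close>)
  have "continuous (at x within {0<..1}) (B2 h)" if x: "x \<in> {0<..1}" for x
  proof -
    have "continuous (at x within {x/2..1}) (B2 h)"
      using c[of "x/2"] x by (simp add: continuous_on_eq_continuous_within)
    moreover have "at x within {x/2..1} = at x within {0<..1}"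
      by (rule at_within_nhd[of _ "{x/2<..}"]) (use x in auto)
    ultimately show ?thesis by simp
  qed
  then have "continuous_on {0<..1} (B2 h)" by (simp add: continuous_on_eq_continuous_within)
  with sqrt_dominated_B2[OF h(2)] show ?thesis by (auto simp: admissible_def)
qed

lemma B2_add:
  assumes "admissible u" "admissible v" "x \<in> {0<..1}"
  shows "B2 (\<lambda>y. u y + v y) x = B2 u x + B2 v x"
proof -
  obtain C D where "sqrt_dominated C u" "sqrt_dominated D v"
    using assms by (auto simp: admissible_def)
  then have s: "summable (\<lambda>k. B2_term u (Suc k) x)" "summable (\<lambda>k. B2_term v (Suc k) x)"
    using assms(3) by (auto intro: summable_B2_term)
  have "B2_term (\<lambda>y. u y + v y) (Suc k) x = B2_term u (Suc k) x + B2_term v (Suc k) x" for k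
    by (simp add: B2_term_def algebra_simps)
  then show ?thesis unfolding B2_def by (simp only: suminf_add[OF s])
qed

lemma B2_uminus:
  assumes "admissible h" "x \<in> {0<..1}"
  shows "B2 (\<lambda>y. - h y) x = - B2 h x"
proof -
  obtain C where "sqrt_dominated C h"
    using assms by (auto simp: admissible_def)
  then have s: "summable (\<lambda>k. B2_term h (Suc k) x)"
    using assms by (auto intro: summable_B2_term)
  have "B2_term (\<lambda>y. - h y) (Suc k) x = - B2_term h (Suc k) x" for k
    by (simp add: B2_term_def algebra_simps)
  then show ?thesis unfolding B2_def by (simp only: suminf_minus[OF s])
qed

lemma B2_mono:
  assumes "admissible u" "admissible v" "\<And>y. y \<in> {0<..1} \<Longrightarrow> u y \<le> v y" "x \<in> {0<..1}"
  shows "B2 u x \<le> B2 v x"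
proof -
  obtain C D where "sqrt_dominated C u" "sqrt_dominated D v"
    using assms by (auto simp: admissible_def)
  then have s: "summable (\<lambda>k. B2_term u (Suc k) x)" "summable (\<lambda>k. B2_term v (Suc k) x)"
    using assms(4) by (auto intro: summable_B2_term)
  show ?thesis unfolding B2_def
    by (rule suminf_le[OF _ s])
       (unfold B2_term_def, intro add_mono mult_left_mono assms(3) branch_in_unit[OF assms(4)] zero_le_power2)
qed

lemma B2_cong:
  assumes "\<And>y. y \<in> {0<..<1} \<Longrightarrow> u y = v y" "x \<in> {0<..1}"
  shows "B2 u x = B2 v x"
  unfolding B2_def B2_term_def by (simp only: assms(1)[OF branch_in_open_unit(1)[OF assms(2)]]
      assms(1)[OF branch_in_open_unit(2)[OF assms(2)]])

lemma admissible_add: "admissible u \<Longrightarrow> admissible v \<Longrightarrow> admissible (\<lambda>y. u y + v y)"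
proof -
  assume a: "admissible u" "admissible v"
  then obtain C D where "sqrt_dominated C u" "sqrt_dominated D v"
    by (auto simp: admissible_def)
  then have "sqrt_dominated (C + D) (\<lambda>y. u y + v y)"
    by (auto simp: sqrt_dominated_def add_divide_distrib intro: order_trans[OF abs_triangle_ineq add_mono])
  with a show ?thesis by (auto simp: admissible_def intro: continuous_intros)
qed

lemma admissible_uminus: "admissible u \<Longrightarrow> admissible (\<lambda>y. - u y)"
  by (auto simp: admissible_def sqrt_dominated_def intro: continuous_intros)

lemma admissible_abs: "admissible u \<Longrightarrow> admissible (\<lambda>y. \<bar>u y\<bar>)"
  by (auto simp: admissible_def sqrt_dominated_def intro: continuous_intros)

lemma admissible_diff: "admissible u \<Longrightarrow> admissible v \<Longrightarrow> admissible (\<lambda>y. u y - v y)"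
  using admissible_add[OF _ admissible_uminus] by fastforce

lemma sqrt_dominated_diff:
  assumes "sqrt_dominated C u" "sqrt_dominated D v"
  shows "sqrt_dominated (C + D) (\<lambda>x. u x - v x)"
  using assms unfolding sqrt_dominated_def
  by (auto simp: add_divide_distrib intro: order_trans[OF abs_triangle_ineq4 add_mono])

lemma B2_diff:
  assumes "admissible u" "admissible v" "x \<in> {0<..1}"
  shows "B2 (\<lambda>y. u y - v y) x = B2 u x - B2 v x"
  using B2_add[OF assms(1) admissible_uminus[OF assms(2)] assms(3)] B2_uminus[OF assms(2,3)] by simp

lemma admissible_B2_iter: "admissible h \<Longrightarrow> admissible ((B2 ^^ n) h)"
  by (induction n) (auto intro: admissible_B2)

lemma B2_iter_add:
  assumes "admissible u" "admissible v" "x \<in> {0<..1}"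
  shows "(B2 ^^ n) (\<lambda>y. u y + v y) x = (B2 ^^ n) u x + (B2 ^^ n) v x"
  using assms(3)
proof (induction n arbitrary: x)
  case (Suc n)
  have "B2 ((B2 ^^ n) (\<lambda>y. u y + v y)) x = B2 (\<lambda>y. (B2 ^^ n) u y + (B2 ^^ n) v y) x"
    by (rule B2_cong) (use Suc in auto)
  also have "\<dots> = B2 ((B2 ^^ n) u) x + B2 ((B2 ^^ n) v) x"
    by (intro B2_add admissible_B2_iter assms Suc)
  finally show ?case by simp
qed simp

lemma B2_iter_uminus:
  assumes "admissible u" "x \<in> {0<..1}"
  shows "(B2 ^^ n) (\<lambda>y. - u y) x = - (B2 ^^ n) u x"
  using assms(2)
proof (induction n arbitrary: x)
  case (Suc n)
  have "B2 ((B2 ^^ n) (\<lambda>y. - u y)) x = B2 (\<lambda>y. - (B2 ^^ n) u y) x"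
    by (rule B2_cong) (use Suc in auto)
  also have "\<dots> = - B2 ((B2 ^^ n) u) x"
    by (intro B2_uminus admissible_B2_iter assms Suc)
  finally show ?case by simp
qed simp

lemma B2_iter_diff:
  assumes "admissible u" "admissible v" "x \<in> {0<..1}"
  shows "(B2 ^^ n) (\<lambda>y. u y - v y) x = (B2 ^^ n) u x - (B2 ^^ n) v x"
  using B2_iter_add[OF assms(1) admissible_uminus[OF assms(2)] assms(3), of n]
    B2_iter_uminus[OF assms(2,3), of n] by simp

lemma sqrt_dominated_B2_iter:
  "sqrt_dominated C h \<Longrightarrow> sqrt_dominated ((1 + sqrt 2) ^ n * C) ((B2 ^^ n) h)"
  by (induction n) (auto simp: mult.assoc intro: sqrt_dominated_B2)

section \<open>The operators F and B2 under differentiation\<close>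

lemma summable_F_term:
  assumes "continuous_on {0..1} H" "x \<in> {0..1}"
  shows "summable (\<lambda>k. F_term H (Suc k) x)"
  using tendsto_uniform_limitI[OF F_uniform_limit(1)[OF assms(1)] assms(2)]
  by (auto simp: summable_def sums_def)

text \<open>
  Termwise differentiation: the factor \<open>1 / 2 ^ k\<close> in \<open>F\<close> cancels one power of \<open>2 ^ k\<close> from the derivative of
  either branch, which leaves exactly the weights of \<open>B2\<close>. The differentiated series converges
  locally uniformly away from \<open>0\<close>.
\<close>
lemma F_has_derivative:
  assumes H: "continuous_on {0..1} H"
    and der: "\<And>x. x \<in> {0<..<1} \<Longrightarrow> (H has_field_derivative h x) (at x)"
    and dom: "sqrt_dominated C h" and x: "x \<in> {0<..<1}"
  shows "(F H has_field_derivative B2 h x) (at x)"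
  unfolding F_def[abs_def] B2_def
proof (rule has_field_derivative_series'(2))
  \<comment> \<open>an interval bounded away from \<open>0\<close>, where the majorants of the terms are uniform\<close>
  show "convex {x/2..1}" by simp
  show "x \<in> interior {x/2..1}" using x by auto
  show "x \<in> {x/2..1}" using x by auto
  show "summable (\<lambda>k. F_term H (Suc k) x)" using H x by (intro summable_F_term) auto
  show "uniformly_convergent_on {x/2..1} (\<lambda>n x. \<Sum>k<n. B2_term h (Suc k) x)"
    using B2_uniform_limit[OF dom, of "x/2"] x by (auto simp: uniformly_convergent_on_def)
  fix n y assume "y \<in> {x/2..1}"
  then have y: "y \<in> {0<..1}" using x by auto
  define K where "K = (2::real) ^ Suc n"
  have K: "K > 0" by (simp add: K_def)
  then have pos: "y + K > 0" "1 + K * y > 0" using y by (auto intro: add_pos_pos)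
  note br = branch_in_open_unit[OF y, of "Suc n", folded K_def]
  have dp: "((\<lambda>y. y / (y + K)) has_field_derivative K / (y + K)\<^sup>2) (at y)"
    using pos by (auto intro!: derivative_eq_intros simp: power2_eq_square)
  have dq: "((\<lambda>y. 1 / (1 + K * y)) has_field_derivative - K / (1 + K * y)\<^sup>2) (at y)"
    using pos by (auto intro!: derivative_eq_intros simp: power2_eq_square)
  have "(F_term H (Suc n) has_field_derivative
     (1 / K) * (h (y / (y + K)) * (K / (y + K)\<^sup>2) - h (1 / (1 + K * y)) * (- K / (1 + K * y)\<^sup>2))) (at y)"
    unfolding F_term_def K_def[symmetric]
    by (intro DERIV_cmult DERIV_diff DERIV_chain2[OF der[OF br(1)] dp] DERIV_chain2[OF der[OF br(2)] dq])
  also have "(1 / K) * (h (y / (y + K)) * (K / (y + K)\<^sup>2) - h (1 / (1 + K * y)) * (- K / (1 + K * y)\<^sup>2))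
     = B2_term h (Suc n) y"
    unfolding B2_term_def K_def[symmetric] using K by (simp add: power_divide field_simps)
  finally show "(F_term H (Suc n) has_field_derivative B2_term h (Suc n) y) (at y within {x/2..1})"
    by (rule DERIV_subset) simp
qed

section \<open>Integrals and the norm of L1\<close>

lemma AE_unit_interval:
  assumes "\<And>x. x \<in> {0<..<1} \<Longrightarrow> P x"
  shows "AE x in lebesgue_on {0..1::real}. P x"
proof -
  have "AE x in lebesgue. x \<notin> {0, 1::real}"
    by (rule AE_not_in) (simp add: negligible_iff_null_sets[symmetric])
  then have "AE x in lebesgue. x \<in> {0..1} \<longrightarrow> P x"
    by eventually_elim (use assms in force)
  then show ?thesis by (simp add: AE_restrict_space_iff)
qed

lemma integrable_inverse_sqrt: "(\<lambda>x. C / sqrt x) integrable_on {0..1}"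
proof -
  have "((\<lambda>x. C / sqrt x) has_integral (2 * C * sqrt 1 - 2 * C * sqrt 0)) {0..1}"
    by (rule fundamental_theorem_of_calculus_interior)
       (auto intro!: continuous_intros derivative_eq_intros
         simp: has_real_derivative_iff_has_vector_derivative[symmetric] field_simps)
  then show ?thesis by blast
qed

lemma admissible_imp_L1:
  assumes "admissible h"
  shows "L1 h"
proof -
  obtain C where h: "continuous_on {0<..1} h" "\<And>x. x \<in> {0<..1} \<Longrightarrow> \<bar>h x\<bar> \<le> C / sqrt x"
    using assms unfolding admissible_def sqrt_dominated_def by blast
  have "(\<lambda>x. C / sqrt x) integrable_on {0<..1}"
    by (rule integrable_spike_set[OF integrable_inverse_sqrt])
       (auto intro: negligible_subset[of "{0}"])
  then have "h absolutely_integrable_on {0<..1}"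
    by (intro measurable_bounded_by_integrable_imp_absolutely_integrable[of _ _ "\<lambda>x. C / sqrt x"]
          continuous_imp_measurable_on_sets_lebesgue h) (auto simp: h)
  moreover have "h absolutely_integrable_on {0<..1} \<longleftrightarrow> h absolutely_integrable_on {0..1}"
    by (rule absolutely_integrable_spike_set_eq) (auto intro: negligible_subset[of "{0}"])
  ultimately show ?thesis using L1_iff by blast
qed

lemma admissible_has_primitive:
  assumes h: "admissible h"
  defines "H \<equiv> \<lambda>x. integral {0..x} h"
  shows "continuous_on {0..1} H"
    and "x \<in> {0<..<1} \<Longrightarrow> (H has_field_derivative h x) (at x)"
proof -
  have int: "h integrable_on {0..1}"
    using admissible_imp_L1[OF h] L1_iff absolutely_integrable_on_def by blast
  show "continuous_on {0..1} H"
    unfolding H_def by (rule indefinite_integral_continuous_1[OF int])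
  assume x: "x \<in> {0<..<1}"
  have "continuous_on {0<..<1} h"
    using h by (auto simp: admissible_def intro: continuous_on_subset)
  then have c: "continuous (at x) h"
    using x by (simp add: continuous_on_eq_continuous_at)
  have "(H has_vector_derivative h x) (at x within {0..1} - {})"
    unfolding H_def
    by (rule integral_has_vector_derivative_continuous_at[OF int])
       (use x c in \<open>auto intro: continuous_at_imp_continuous_at_within\<close>)
  moreover have "at x within {0..1} - {} = at x"
    using x by (intro at_within_interior) auto
  ultimately show "(H has_field_derivative h x) (at x)"
    by (simp add: has_real_derivative_iff_has_vector_derivative)
qed

lemma integral_eq_primitive_diff:
  assumes h: "L1 h" and H: "continuous_on {0..1} H"
    and der: "\<And>x. x \<in> {0<..<1} \<Longrightarrow> (H has_field_derivative h x) (at x)"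
  shows "(LINT x|lebesgue_on {0..1}. h x) = H 1 - H 0"
proof -
  have "(h has_integral (H 1 - H 0)) {0..1}"
    by (rule fundamental_theorem_of_calculus_interior[OF _ H])
       (use der in \<open>auto simp: has_real_derivative_iff_has_vector_derivative[symmetric]\<close>)
  then show ?thesis using lebesgue_integral_eq_integral[OF h] by (simp add: integral_unique)
qed

lemma L1_mono:
  assumes "L1 u" "L1 v" "\<And>x. x \<in> {0<..<1} \<Longrightarrow> u x \<le> v x"
  shows "(LINT x|lebesgue_on {0..1}. u x) \<le> (LINT x|lebesgue_on {0..1}. v x)"
  by (rule integral_mono_AE[OF assms(1,2) AE_unit_interval]) (rule assms(3))

lemma L1_integral_cong:
  assumes "L1 u" "L1 v" "\<And>x. x \<in> {0<..<1} \<Longrightarrow> u x = v x"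
  shows "(LINT x|lebesgue_on {0..1}. u x) = (LINT x|lebesgue_on {0..1}. v x)"
  by (intro antisym L1_mono assms) (simp_all add: assms(3))

lemma L1_cong:
  assumes "L1 u" "\<And>x. x \<in> {0<..<1} \<Longrightarrow> v x = u x"
  shows "L1 v"
proof -
  have "u absolutely_integrable_on {0..1}" using assms(1) L1_iff by blast
  then have "v absolutely_integrable_on {0..1}"
    by (rule absolutely_integrable_spike[where S = "{0, 1}"]) (simp_all add: assms(2))
  then show ?thesis using L1_iff by blast
qed

lemma abs_le_integral_abs_deriv:
  assumes v: "L1 v" and G: "continuous_on {0..1} G"
    and der: "\<And>x. x \<in> {0<..<1} \<Longrightarrow> (G has_field_derivative v x) (at x)" and x: "x \<in> {0..1}"
  shows "\<bar>G x - G 0\<bar> \<le> (LINT x|lebesgue_on {0..1}. \<bar>v x\<bar>)"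
proof -
  have abs: "(\<lambda>x. \<bar>v x\<bar>) absolutely_integrable_on {0..1}"
    using v L1_iff integrable_abs by blast
  then have int: "(\<lambda>x. \<bar>v x\<bar>) integrable_on {0..1}" by (rule set_lebesgue_integral_eq_integral)
  then have int': "(\<lambda>x. \<bar>v x\<bar>) integrable_on {0..x}"
    by (rule integrable_on_subinterval) (use x in auto)
  have h: "(v has_integral (G x - G 0)) {0..x}"
    by (rule fundamental_theorem_of_calculus_interior)
       (use x der in \<open>auto simp: has_real_derivative_iff_has_vector_derivative[symmetric]
          intro: continuous_on_subset[OF G]\<close>)
  then have "norm (integral {0..x} v) \<le> integral {0..x} (\<lambda>x. \<bar>v x\<bar>)"
    by (intro integral_norm_bound_integral int') auto
  also have "\<dots> \<le> integral {0..1} (\<lambda>x. \<bar>v x\<bar>)"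
    by (intro integral_subset_le int int') (use x in auto)
  also have "\<dots> = (LINT x|lebesgue_on {0..1}. \<bar>v x\<bar>)"
    by (rule lebesgue_integral_eq_integral[symmetric]) (use v in auto)
  finally show ?thesis using h by (simp add: integral_unique)
qed

lemma F_at_1: "F h 1 = 0"
  by (simp add: F_def F_term_def add.commute)

lemma F_at_0: "F h 0 = h 0 - h 1"
proof -
  have "(\<lambda>k. F_term h (Suc k) 0) = (\<lambda>k. (1 / 2) ^ Suc k * (h 0 - h 1))"
    by (simp add: F_term_def power_one_over)
  then show ?thesis
    using sums_mult2[OF power_half_series, of "h 0 - h 1"] by (simp add: F_def sums_iff del: power_Suc)
qed

text \<open>
  With a primitive \<open>H\<close> of \<open>h\<close>, the function \<open>F H\<close> is a primitive of \<open>B2 h\<close>, and \<open>F\<close> preserves the increment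
  \<open>H 1 - H 0\<close>: at \<open>1\<close> the two branches coincide, and at \<open>0\<close> they take the values \<open>0\<close> and \<open>1\<close>. This replaces a
  change of variables for every branch.
\<close>
lemma B2_preserves_integral:
  assumes h: "admissible h"
  shows "(LINT x|lebesgue_on {0..1}. B2 h x) = (LINT x|lebesgue_on {0..1}. h x)"
proof -
  define H where "H = (\<lambda>x. integral {0..x} h)"
  note H = admissible_has_primitive[OF h, folded H_def]
  obtain C where C: "sqrt_dominated C h" using h by (auto simp: admissible_def)
  have "(LINT x|lebesgue_on {0..1}. B2 h x) = F H 1 - F H 0"
    by (intro integral_eq_primitive_diff admissible_imp_L1 admissible_B2 h F_uniform_limit H
          F_has_derivative[OF H(1) _ C])
  also have "\<dots> = H 1 - H 0" by (simp add: F_at_0 F_at_1)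
  also have "\<dots> = (LINT x|lebesgue_on {0..1}. h x)"
    by (intro integral_eq_primitive_diff[symmetric] admissible_imp_L1 h H)
  finally show ?thesis .
qed

lemma B2_iter_preserves_integral:
  assumes "admissible h"
  shows "(LINT x|lebesgue_on {0..1}. (B2 ^^ n) h x) = (LINT x|lebesgue_on {0..1}. h x)"
  by (induction n) (simp_all add: B2_preserves_integral admissible_B2_iter assms)

lemma abs_B2_le:
  assumes "admissible h" "x \<in> {0<..1}"
  shows "\<bar>B2 h x\<bar> \<le> B2 (\<lambda>y. \<bar>h y\<bar>) x"
proof -
  have "B2 h x \<le> B2 (\<lambda>y. \<bar>h y\<bar>) x"
    by (intro B2_mono admissible_abs assms) auto
  moreover have "- B2 h x \<le> B2 (\<lambda>y. \<bar>h y\<bar>) x"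
    unfolding B2_uminus[OF assms, symmetric] by (intro B2_mono admissible_abs admissible_uminus assms) auto
  ultimately show ?thesis by simp
qed

lemma abs_B2_iter_le:
  assumes "admissible h" "x \<in> {0<..1}"
  shows "\<bar>(B2 ^^ n) h x\<bar> \<le> (B2 ^^ n) (\<lambda>y. \<bar>h y\<bar>) x"
  using assms(2)
proof (induction n arbitrary: x)
  case (Suc n)
  have "\<bar>B2 ((B2 ^^ n) h) x\<bar> \<le> B2 (\<lambda>y. \<bar>(B2 ^^ n) h y\<bar>) x"
    by (intro abs_B2_le admissible_B2_iter assms Suc.prems)
  also have "\<dots> \<le> B2 ((B2 ^^ n) (\<lambda>y. \<bar>h y\<bar>)) x"
    by (intro B2_mono admissible_abs admissible_B2_iter assms Suc)
  finally show ?case by simp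
qed simp

lemma B2_L1_contraction:
  assumes h: "admissible h"
  shows "(LINT x|lebesgue_on {0..1}. \<bar>B2 h x\<bar>) \<le> (LINT x|lebesgue_on {0..1}. \<bar>h x\<bar>)"
proof -
  have "(LINT x|lebesgue_on {0..1}. \<bar>B2 h x\<bar>) \<le> (LINT x|lebesgue_on {0..1}. B2 (\<lambda>y. \<bar>h y\<bar>) x)"
    by (intro L1_mono admissible_imp_L1 admissible_abs admissible_B2 h abs_B2_le) auto
  also have "\<dots> = (LINT x|lebesgue_on {0..1}. \<bar>h x\<bar>)"
    by (intro B2_preserves_integral admissible_abs h)
  finally show ?thesis .
qed

text \<open>
  Continuity upgrades almost-everywhere vanishing to vanishing everywhere, including the end point
  \<open>1\<close>, which is where \<open>B2_rigid\<close> evaluates the function.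
\<close>
lemma admissible_nonneg_integral_0:
  assumes h: "admissible h" and nn: "\<And>x. x \<in> {0<..<1} \<Longrightarrow> 0 \<le> h x"
    and 0: "(LINT x|lebesgue_on {0..1}. h x) = 0" and x: "x \<in> {0<..1}"
  shows "h x = 0"
proof -
  have int: "h integrable_on {0..1}"
    using admissible_imp_L1[OF h] L1_iff absolutely_integrable_on_def by blast
  have *: "integral {0..1} h = 0"
    using lebesgue_integral_eq_integral[OF admissible_imp_L1[OF h]] 0 by simp
  have sub: "h integrable_on {x/2..1}" "h integrable_on {0..x/2}"
    using x by (auto intro: integrable_on_subinterval[OF int])
  have nn': "0 \<le> integral {a..b} h" if "0 \<le> a" "b \<le> 1" for a b
  proof -
    have "h integrable_on {a<..<b}"
      using integrable_on_subinterval[OF int, of a b] that by (simp add: integrable_on_open_interval_real)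
    then have "0 \<le> integral {a<..<b} h"
      using that by (intro integral_nonneg nn) auto
    then show ?thesis by (simp add: integral_open_interval_real)
  qed
  have "integral {0..x/2} h + integral {x/2..1} h = 0"
    using Henstock_Kurzweil_Integration.integral_combine[OF _ _ int, of "x/2"] x * by simp
  then have "integral {x/2..1} h = 0"
    using nn'[of 0 "x/2"] nn'[of "x/2" 1] x by (simp add: add_nonneg_eq_0_iff)
  with sub(1) have int0: "(h has_integral 0) (cbox (x/2) 1)"
    by (simp add: has_integral_iff)
  have cont: "continuous_on (cbox (x/2) 1) h"
    using h x by (auto simp: admissible_def intro: continuous_on_subset)
  show ?thesis
    by (rule has_integral_0_cbox_imp_0[OF cont _ int0]) (use x nn in auto)
qed

section \<open>The invariant cone and compactness\<close>

text \<open>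
  The cone of densities that \<open>B2\<close> leaves invariant. Monotonicity of \<open>x\<^sup>2 * f x\<close> is needed besides that of
  \<open>f\<close> because the branch \<open>1 / (1 + K * x)\<close> reverses the order: the weight \<open>(1 / (1 + K * x))\<^sup>2\<close> turns
  \<open>f\<close> at this branch into \<open>y\<^sup>2 * f y\<close> with \<open>y\<close> decreasing in \<open>x\<close>.
\<close>
definition tame :: "(real \<Rightarrow> real) \<Rightarrow> bool" where
  "tame f \<longleftrightarrow> (\<forall>x\<in>{0<..1}. 0 \<le> f x) \<and> (\<forall>x\<in>{0<..1}. \<forall>y\<in>{0<..1}. x \<le> y \<longrightarrow> f y \<le> f x \<and> x\<^sup>2 * f x \<le> y\<^sup>2 * f y)"

lemma tameD:
  assumes "tame f"
  shows "x \<in> {0<..1} \<Longrightarrow> 0 \<le> f x"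
    and "x \<in> {0<..1} \<Longrightarrow> y \<in> {0<..1} \<Longrightarrow> x \<le> y \<Longrightarrow> f y \<le> f x"
    and "x \<in> {0<..1} \<Longrightarrow> y \<in> {0<..1} \<Longrightarrow> x \<le> y \<Longrightarrow> x\<^sup>2 * f x \<le> y\<^sup>2 * f y"
  using assms unfolding tame_def by blast+

text \<open>
  Each of the two summands of \<open>B2_term\<close> uses one of the two monotonicity conditions directly, and
  exchanges them: for the branch \<open>p = x / (x + K)\<close> the product of \<open>x\<^sup>2\<close> with the summand is \<open>p\<^sup>2 * f p\<close>, and for
  \<open>q = 1 / (1 + K * x)\<close> the summand itself is \<open>q\<^sup>2 * f q\<close>.
\<close>
lemma tame_B2_term:
  assumes f: "tame f"
  shows "tame (B2_term f k)"
proof -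
  define K where "K = (2::real) ^ k"
  have K: "K \<ge> 1" by (simp add: K_def)
  note br = branch_in_unit[of _ k, folded K_def]
  show ?thesis
    unfolding tame_def
  proof (intro conjI ballI impI)
    fix x :: real assume x: "x \<in> {0<..1}"
    show "0 \<le> B2_term f k x"
      unfolding B2_term_def K_def[symmetric]
      by (intro add_nonneg_nonneg mult_nonneg_nonneg tameD(1)[OF f] br x zero_le_power2)
  next
    fix x y :: real assume x: "x \<in> {0<..1}" and y: "y \<in> {0<..1}" and xy: "x \<le> y"
    have pos: "0 < x + K" "0 < 1 + K * x" "0 < y + K" "0 < 1 + K * y"
      using x y K by (auto intro!: add_pos_pos)
    have p: "x / (x + K) \<le> y / (y + K)"
      using pos xy K by (simp add: divide_simps) (simp add: algebra_simps)
    have q: "1 / (1 + K * y) \<le> 1 / (1 + K * x)"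
      using pos xy K by (simp add: divide_simps)
    have p': "1 / (y + K) \<le> 1 / (x + K)"
      using pos xy by (simp add: divide_simps)
    have q': "x / (1 + K * x) \<le> y / (1 + K * y)"
      using pos xy by (simp add: divide_simps) (simp add: algebra_simps)
    show "B2_term f k y \<le> B2_term f k x"
      unfolding B2_term_def K_def[symmetric]
    proof (rule add_mono)
      show "(1 / (y + K))\<^sup>2 * f (y / (y + K)) \<le> (1 / (x + K))\<^sup>2 * f (x / (x + K))"
        by (intro mult_mono power_mono tameD[OF f] br x y p p') (use pos in auto)
      show "(1 / (1 + K * y))\<^sup>2 * f (1 / (1 + K * y)) \<le> (1 / (1 + K * x))\<^sup>2 * f (1 / (1 + K * x))"
        by (intro tameD[OF f] br x y q)
    qed
    have "x\<^sup>2 * B2_term f k x = (x / (x + K))\<^sup>2 * f (x / (x + K)) + (x / (1 + K * x))\<^sup>2 * f (1 / (1 + K * x))"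
      by (simp add: B2_term_def K_def[symmetric] power_divide distrib_left)
    also have "\<dots> \<le> (y / (y + K))\<^sup>2 * f (y / (y + K)) + (y / (1 + K * y))\<^sup>2 * f (1 / (1 + K * y))"
    proof (rule add_mono)
      show "(x / (x + K))\<^sup>2 * f (x / (x + K)) \<le> (y / (y + K))\<^sup>2 * f (y / (y + K))"
        by (intro tameD[OF f] br x y p)
      show "(x / (1 + K * x))\<^sup>2 * f (1 / (1 + K * x)) \<le> (y / (1 + K * y))\<^sup>2 * f (1 / (1 + K * y))"
        by (intro mult_mono power_mono tameD[OF f] br x y q q') (use pos x in auto)
    qed
    also have "\<dots> = y\<^sup>2 * B2_term f k y"
      by (simp add: B2_term_def K_def[symmetric] power_divide distrib_left)
    finally show "x\<^sup>2 * B2_term f k x \<le> y\<^sup>2 * B2_term f k y" .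
  qed
qed

lemma tame_B2:
  assumes f: "tame f" and dom: "sqrt_dominated C f"
  shows "tame (B2 f)"
proof -
  note s = summable_B2_term[OF dom]
  note t = tameD[OF tame_B2_term[OF f]]
  show ?thesis
    unfolding tame_def B2_def
    by (intro conjI ballI impI suminf_nonneg suminf_le s t)
       (simp_all only: suminf_mult[OF s, symmetric], intro suminf_le summable_mult s t)
qed

text \<open>
  The constant \<open>4\<close> reproduces itself. The branches \<open>x / (x + 2 ^ k)\<close> contribute at most \<open>4 / sqrt x\<close> times the
  geometric sum of \<open>r ^ (3 * k)\<close> with \<open>r = 1 / sqrt 2\<close>, a factor below \<open>0.6\<close>. For the other branches
  the bound \<open>1 / x\<close>, which does not involve the constant, gives at most \<open>(5 / 4) / sqrt x\<close>. The total
  stays below \<open>4 / sqrt x\<close>.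
\<close>
lemma tame_dominated_B2:
  assumes dom: "sqrt_dominated 4 f" and nn: "\<And>x. x \<in> {0<..1} \<Longrightarrow> 0 \<le> f x"
    and inv: "\<And>x. x \<in> {0<..<1} \<Longrightarrow> f x \<le> 1 / x"
  shows "sqrt_dominated 4 (B2 f)"
  unfolding sqrt_dominated_def
proof
  fix x :: real assume x: "x \<in> {0<..1}"
  define r where "r = 1 / sqrt 2"
  have r: "0 < r" "r \<le> 5 / 7"
  proof -
    have "7 / 5 \<le> sqrt 2" by (rule real_le_rsqrt) (simp add: power2_eq_square)
    then show "r \<le> 5 / 7" "0 < r" by (simp_all add: r_def field_simps)
  qed
  have r3: "r ^ 3 \<le> (5 / 7) ^ 3" using r by (intro power_mono) auto
  then have r3_1: "r ^ 3 < 1" by (rule le_less_trans) (simp add: power3_eq_cube)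
  have s1: "(\<lambda>k. (r ^ 3) ^ Suc k) sums (r ^ 3 / (1 - r ^ 3))"
    using sums_mult[OF geometric_sums[of "r ^ 3"], of "r ^ 3"] r3_1 r by simp
  have s2: "(\<lambda>k. r ^ Suc k) sums (r / (1 - r))"
    using sums_mult[OF geometric_sums[of r], of r] r by simp
  have "(\<lambda>k. 4 / sqrt x * (r ^ 3) ^ Suc k + 1 / sqrt x * (1 / 2 * r ^ Suc k))
      sums (4 / sqrt x * (r ^ 3 / (1 - r ^ 3)) + 1 / sqrt x * (1 / 2 * (r / (1 - r))))"
    by (intro sums_add sums_mult s1 s2)
  note S = this
  have le: "B2_term f (Suc k) x \<le> 4 / sqrt x * (r ^ 3) ^ Suc k + 1 / sqrt x * (1 / 2 * r ^ Suc k)" for k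
  proof -
    define K where "K = (2::real) ^ Suc k"
    have K: "K > 0" "1 / sqrt K = r ^ Suc k"
      unfolding K_def r_def by (simp, rule sqrt_2_power)
    note br = branch_in_unit[OF x, of "Suc k", folded K_def]
      and bo = branch_in_open_unit[OF x, of "Suc k", folded K_def]
    have "1 / (K * sqrt K) = (1 / sqrt K) ^ 3"
      using K(1) by (simp add: power3_eq_cube)
    then have K3: "1 / (K * sqrt K) = (r ^ 3) ^ Suc k"
      unfolding K(2) by (simp only: power_mult[symmetric] mult.commute)
    have "(1 / (x + K))\<^sup>2 * f (x / (x + K)) \<le> (1 / (x + K))\<^sup>2 * (4 / sqrt (x / (x + K)))"
      using dom br(1) by (intro mult_left_mono) (auto simp: sqrt_dominated_def dest!: bspec)
    also have "\<dots> \<le> 4 / sqrt x * (r ^ 3) ^ Suc k"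
      using small_branch_weight[of x K 4] x K by (simp only: K3) simp
    finally have 1: "(1 / (x + K))\<^sup>2 * f (x / (x + K)) \<le> 4 / sqrt x * (r ^ 3) ^ Suc k" .
    have "(1 / (1 + K * x))\<^sup>2 * f (1 / (1 + K * x)) \<le> (1 / (1 + K * x))\<^sup>2 * (1 / (1 / (1 + K * x)))"
      by (intro mult_left_mono inv bo) simp
    also have "\<dots> = 1 / (1 + K * x)"
      using bo(2) by (simp add: power2_eq_square)
    also have "\<dots> \<le> 1 / sqrt x * (1 / 2 * r ^ Suc k)"
    proof -
      have "1 / (2 * sqrt K) = 1 / 2 * r ^ Suc k"
        unfolding K(2)[symmetric] by simp
      then show ?thesis using large_branch_le[of x K] x K(1) by (simp only: greaterThanAtMost_iff)
    qed
    finally show ?thesis using 1 unfolding B2_term_def K_def[symmetric] by linarith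
  qed
  have "B2 f x \<le> 4 / sqrt x * (r ^ 3 / (1 - r ^ 3)) + 1 / sqrt x * (1 / 2 * (r / (1 - r)))"
    using sums_le[OF le summable_sums[OF summable_B2_term[OF dom x]] S] by (simp add: B2_def)
  also have "\<dots> = 1 / sqrt x * (4 * (r ^ 3 / (1 - r ^ 3)) + 1 / 2 * (r / (1 - r)))"
    by (simp add: algebra_simps)
  also have "\<dots> \<le> 1 / sqrt x * (4 * ((5 / 7) ^ 3 / (1 - (5 / 7) ^ 3)) + 1 / 2 * ((5 / 7) / (1 - 5 / 7)))"
    using r r3 x by (intro mult_left_mono add_mono frac_le) (auto simp: power3_eq_cube)
  also have "\<dots> \<le> 1 / sqrt x * 4"
    using x by (intro mult_left_mono) (auto simp: power3_eq_cube)
  finally have "B2 f x \<le> 4 / sqrt x" by simp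
  moreover have "0 \<le> B2 f x"
    unfolding B2_def
    by (intro suminf_nonneg summable_B2_term[OF dom x])
       (unfold B2_term_def, intro add_nonneg_nonneg mult_nonneg_nonneg nn branch_in_unit x zero_le_power2)
  ultimately show "\<bar>B2 f x\<bar> \<le> 4 / sqrt x" by simp
qed

text \<open>
  By \<open>g_has_derivative\<close> this is \<open>- g\<^sub>n'\<close> on the open interval; unlike \<open>deriv (g n)\<close>, it is also
  meaningful at the end point \<open>1\<close>.
\<close>
definition g_density :: "nat \<Rightarrow> real \<Rightarrow> real" where
  "g_density n = (B2 ^^ n) (\<lambda>x. 1)"

lemma g_density_Suc: "g_density (Suc n) = B2 (g_density n)" by (simp add: g_density_def)

lemma g_density_add: "g_density (n + m) = (B2 ^^ m) (g_density n)"
  by (simp add: g_density_def funpow_add add.commute[of n])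

lemma admissible_g_density: "admissible (g_density n)"
proof -
  have "sqrt_dominated 1 (\<lambda>x. 1)" by (auto simp: sqrt_dominated_def field_simps)
  then have "admissible (\<lambda>x. 1)" by (auto simp: admissible_def intro: continuous_intros)
  then show ?thesis unfolding g_density_def by (rule admissible_B2_iter)
qed

lemma g_has_derivative:
  assumes "x \<in> {0<..<1}"
  shows "(g n has_field_derivative - g_density n x) (at x)"
  using assms
proof (induction n arbitrary: x)
  case 0
  show ?case by (auto simp: g_density_def intro!: derivative_eq_intros)
next
  case (Suc n)
  note a = admissible_uminus[OF admissible_g_density[of n]]
  then obtain C where "sqrt_dominated C (\<lambda>x. - g_density n x)" by (auto simp: admissible_def)
  from F_has_derivative[OF continuous_on_g Suc.IH this Suc.prems]
  show ?case using B2_uminus[OF admissible_g_density, of x n] Suc.prems by (simp add: g_density_Suc)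
qed

lemma g_at_1: "g n 1 = 0"
  by (cases n) (simp_all add: F_at_1)

lemma g_at_0: "g n 0 = 1"
  by (induction n) (simp_all add: F_at_0 g_at_1)

text \<open>
  A decreasing density of total mass one: \<open>x * f x\<close> is at most the mass of \<open>{0..x}\<close>.
\<close>
lemma tame_le_inverse:
  assumes f: "tame f" and G: "continuous_on {0..1} G"
    and der: "\<And>x. x \<in> {0<..<1} \<Longrightarrow> (G has_field_derivative - f x) (at x)"
    and G01: "G 0 = 1" "G 1 = 0" and x: "x \<in> {0<..<1}"
  shows "f x \<le> 1 / x"
proof -
  have "\<exists>l z. 0 < z \<and> z < x \<and> (G has_real_derivative l) (at z) \<and> G x - G 0 = (x - 0) * l"
    by (rule MVT) (use x der in \<open>auto intro!: continuous_on_subset[OF G]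
         simp: real_differentiable_def, meson less_trans\<close>)
  then obtain l z where z: "0 < z" "z < x" "(G has_real_derivative l) (at z)" "G x - G 0 = x * l"
    by auto
  have l: "l = - f z" using DERIV_unique[OF z(3) der[of z]] z x by auto
  have "G 1 \<le> G x"
  proof (rule DERIV_nonpos_imp_decreasing_open[where a = x and b = 1 and f = G])
    show "x \<le> 1" using x by simp
    show "\<exists>y. (G has_real_derivative y) (at t) \<and> y \<le> 0" if "x < t" "t < 1" for t
      using der[of t] tameD(1)[OF f, of t] that x by (intro exI[of _ "- f t"]) auto
    show "continuous_on {x..1} G" using x by (intro continuous_on_subset[OF G]) auto
  qed
  then have "x * f z \<le> 1" using z(4) l G01 by simp
  moreover have "x * f x \<le> x * f z"
    using x z by (intro mult_left_mono tameD(2)[OF f]) auto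
  ultimately have "x * f x \<le> 1" by linarith
  then show ?thesis using x by (simp add: field_simps)
qed

text \<open>
  The two claims and the primitive \<open>g n\<close> must go through one induction: the bound on \<open>B2 f\<close> needs
  \<open>f x \<le> 1 / x\<close>, which the cone alone does not give and which \<open>B2\<close> does not preserve; it is
  recovered in each step from the values of \<open>g n\<close> at the end points.
\<close>
lemma g_density_tame: "tame (g_density n) \<and> sqrt_dominated 4 (g_density n)"
proof (induction n)
  case 0
  have "1 \<le> 4 / sqrt x" if "x \<in> {0<..1}" for x
  proof -
    have "0 < sqrt x" "sqrt x \<le> 1" using that by auto
    then have "sqrt x \<le> 4" by linarith
    with \<open>0 < sqrt x\<close> show ?thesis by (simp add: le_divide_eq)
  qed
  then show ?case by (auto simp: g_density_def tame_def sqrt_dominated_def power_mono)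
next
  case (Suc n)
  then have t: "tame (g_density n)" "sqrt_dominated 4 (g_density n)" by auto
  have "g_density n x \<le> 1 / x" if "x \<in> {0<..<1}" for x
    by (rule tame_le_inverse[OF t(1) continuous_on_g g_has_derivative g_at_0 g_at_1 that])
  then show ?case
    unfolding g_density_Suc using tame_B2[OF t] tame_dominated_B2[OF t(2) tameD(1)[OF t(1)]] by blast
qed

text \<open>
  As \<open>f\<close> decreases, the increment of \<open>x\<^sup>2 * f x\<close> from \<open>x\<close> to \<open>y\<close> is at most
  \<open>(y\<^sup>2 - x\<^sup>2) * f y \<le> (y - x) * (2 * y * f y)\<close>, and \<open>y * f y \<le> 4 * sqrt y\<close>.
\<close>
lemma tame_lipschitz:
  assumes f: "tame f" "sqrt_dominated 4 f" and x: "x \<in> {0..1}" and y: "y \<in> {0..1}"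
  shows "\<bar>x\<^sup>2 * f x - y\<^sup>2 * f y\<bar> \<le> 8 * \<bar>x - y\<bar>"
proof -
  have id: "z * f z \<le> 4" if z: "z \<in> {0<..1}" for z
  proof -
    have "z * f z \<le> z * (4 / sqrt z)"
      using f(2) z by (intro mult_left_mono) (auto simp: sqrt_dominated_def dest!: bspec)
    also have "\<dots> = 4 * sqrt z"
      using z by (simp add: field_simps)
    also have "\<dots> \<le> 4" using z by simp
    finally show ?thesis .
  qed
  have *: "\<bar>x\<^sup>2 * f x - y\<^sup>2 * f y\<bar> \<le> 8 * \<bar>x - y\<bar>" if x: "x \<in> {0..1}" and y: "y \<in> {0..1}" and xy: "x < y" for x y
  proof (cases "x = 0")
    case True
    then have y0: "y \<in> {0<..1}" using y xy by auto
    have "y * (y * f y) \<le> y * 8" using id[OF y0] y0 by (intro mult_left_mono) auto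
    then show ?thesis using True y0 tameD(1)[OF f(1) y0] by (simp add: power2_eq_square mult_ac)
  next
    case False
    then have m: "x \<in> {0<..1}" "y \<in> {0<..1}" using x y xy by auto
    have "y\<^sup>2 * f y - x\<^sup>2 * f x \<le> y\<^sup>2 * f y - x\<^sup>2 * f y"
      using tameD(2)[OF f(1) m] xy by (intro diff_left_mono mult_left_mono) auto
    also have "\<dots> = (y - x) * ((x + y) * f y)" by (simp add: power2_eq_square algebra_simps)
    also have "\<dots> \<le> (y - x) * ((y + y) * f y)"
      using xy m tameD(1)[OF f(1) m(2)] by (intro mult_left_mono mult_right_mono) auto
    also have "\<dots> \<le> (y - x) * 8" using id[OF m(2)] xy by (intro mult_left_mono) (auto simp: distrib_right)
    finally show ?thesis using tameD(3)[OF f(1) m] xy by simp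
  qed
  show ?thesis
  proof (cases x y rule: linorder_cases)
    case less then show ?thesis using * x y by blast
  next
    case greater then show ?thesis using *[of y x] x y by (simp add: abs_minus_commute)
  qed simp
qed

text \<open>
  Arzela-Ascoli is applied to \<open>x\<^sup>2 * u n x\<close>, which unlike \<open>u n\<close> extends continuously to \<open>0\<close>.
\<close>
lemma tame_subsequence:
  fixes u :: "nat \<Rightarrow> real \<Rightarrow> real"
  assumes u: "\<And>n. tame (u n)" "\<And>n. sqrt_dominated 4 (u n)"
  obtains f r where "strict_mono (r :: nat \<Rightarrow> nat)" "admissible f"
    "\<And>x. x \<in> {0<..1} \<Longrightarrow> (\<lambda>n. u (r n) x) \<longlonglongrightarrow> f x"
proof -
  define \<phi> where "\<phi> = (\<lambda>n x. x\<^sup>2 * u n x)"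
  have lip: "norm (\<phi> n x - \<phi> n y) \<le> 8 * \<bar>x - y\<bar>" if "x \<in> {0..1}" "y \<in> {0..1}" for n x y
    using tame_lipschitz[OF u that] by (simp add: \<phi>_def)
  obtain \<psi> r where \<psi>: "continuous_on {0..1} \<psi>" "strict_mono (r :: nat \<Rightarrow> nat)"
    and lim: "\<And>e. 0 < e \<Longrightarrow> \<exists>N. \<forall>n x. n \<ge> N \<and> x \<in> {0..1} \<longrightarrow> norm (\<phi> (r n) x - \<psi> x) < e"
  proof (rule Arzela_Ascoli[of "{0..1::real}" \<phi> 8])
    show "norm (\<phi> n x) \<le> 8" if "x \<in> {0..1}" for n x
      using lip[OF that, of 0 n] that by (simp add: \<phi>_def)
    show "\<exists>d>0. \<forall>n y. y \<in> {0..1} \<and> norm (x - y) < d \<longrightarrow> norm (\<phi> n x - \<phi> n y) < e"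
      if "x \<in> {0..1}" "0 < e" for x e
    proof (intro exI[of _ "e / 8"] conjI allI impI)
      fix n y assume y: "y \<in> {0..1} \<and> norm (x - y) < e / 8"
      then have "norm (\<phi> n x - \<phi> n y) \<le> 8 * \<bar>x - y\<bar>" using lip that by blast
      also have "\<dots> < e" using y by simp
      finally show "norm (\<phi> n x - \<phi> n y) < e" .
    qed (use that in auto)
  qed auto
  define f where "f = (\<lambda>x. \<psi> x / x\<^sup>2)"
  have "(\<lambda>n. \<phi> (r n) x) \<longlonglongrightarrow> \<psi> x" if "x \<in> {0..1}" for x
    unfolding LIMSEQ_iff using lim that by blast
  then have "(\<lambda>n. \<phi> (r n) x / x\<^sup>2) \<longlonglongrightarrow> f x" if "x \<in> {0<..1}" for x
    unfolding f_def using that by (intro tendsto_intros) auto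
  then have conv: "(\<lambda>n. u (r n) x) \<longlonglongrightarrow> f x" if "x \<in> {0<..1}" for x
    using that by (simp add: \<phi>_def)
  have "continuous_on {0<..1} \<psi>" by (rule continuous_on_subset[OF \<psi>(1)]) auto
  then have "continuous_on {0<..1} f"
    unfolding f_def by (intro continuous_intros) auto
  moreover have "sqrt_dominated 4 f"
    unfolding sqrt_dominated_def
  proof
    fix x :: real assume x: "x \<in> {0<..1}"
    show "\<bar>f x\<bar> \<le> 4 / sqrt x"
      by (rule LIMSEQ_le_const2[OF tendsto_rabs[OF conv[OF x]]])
         (use u(2) x in \<open>auto simp: sqrt_dominated_def\<close>)
  qed
  ultimately have "admissible f" by (auto simp: admissible_def)
  then show ?thesis using that \<psi>(2) conv by blast
qed

section \<open>Exactness\<close>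

text \<open>
  Encodes by \<open>w\<close> the point \<open>x = 1 / (1 + w)\<close>. The branch \<open>x / (x + 2 ^ k)\<close> sends the code \<open>w\<close> to
  \<open>2 ^ k * (1 + w)\<close>, so these are the codes of the points reached from \<open>1\<close> by \<open>n\<close> branches of this
  kind. They are the even numbers with exactly \<open>n\<close> binary digits equal to one.
\<close>
primrec unit_preimages :: "nat \<Rightarrow> nat set" where
  "unit_preimages 0 = {0}"
| "unit_preimages (Suc n) = {2 ^ Suc l * (1 + w) |l w. w \<in> unit_preimages n}"

lemma B2_pos:
  assumes h: "admissible h" and nn: "\<And>y. y \<in> {0<..1} \<Longrightarrow> 0 \<le> h y" and x: "x \<in> {0<..1}"
    and pos: "0 < h (x / (x + 2 ^ Suc k)) \<or> 0 < h (1 / (1 + 2 ^ Suc k * x))"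
  shows "0 < B2 h x"
proof -
  obtain C where C: "sqrt_dominated C h" using h by (auto simp: admissible_def)
  note br = branch_in_unit[OF x]
  have w: "0 < (1 / (x + 2 ^ Suc k))\<^sup>2" "0 < (1 / (1 + 2 ^ Suc k * x))\<^sup>2"
    using br[of "Suc k"] by (auto simp del: power_Suc)
  show ?thesis
    unfolding B2_def
  proof (rule suminf_pos2[OF summable_B2_term[OF C x]])
    show "0 \<le> B2_term h (Suc n) x" for n
      unfolding B2_term_def by (intro add_nonneg_nonneg mult_nonneg_nonneg nn br zero_le_power2)
    have "0 \<le> h (x / (x + 2 ^ Suc k))" "0 \<le> h (1 / (1 + 2 ^ Suc k * x))"
      by (intro nn br)+
    then show "0 < B2_term h (Suc k) x"
      unfolding B2_term_def using pos w
      by (metis add_nonneg_pos add_pos_nonneg mult_nonneg_nonneg mult_pos_pos less_imp_le)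
  qed
qed

lemma B2_nonneg:
  assumes h: "admissible h" and nn: "\<And>y. y \<in> {0<..1} \<Longrightarrow> 0 \<le> h y" and x: "x \<in> {0<..1}"
  shows "0 \<le> B2 h x"
  using abs_B2_le[OF h x] B2_mono[OF admissible_abs[OF h] h _ x] nn by fastforce

text \<open>
  Positivity travels backwards along the path of branches encoded by \<open>w\<close>.
\<close>
lemma B2_iter_pos_at_1:
  assumes "admissible h" "\<And>y. y \<in> {0<..1} \<Longrightarrow> 0 \<le> h y"
    and "w \<in> unit_preimages n" "0 < h (1 / (1 + real w))"
  shows "0 < (B2 ^^ n) h 1"
  using assms
proof (induction n arbitrary: h w)
  case 0
  then show ?case by simp
next
  case (Suc n)
  obtain l v where v: "v \<in> unit_preimages n" and w: "w = 2 ^ Suc l * (1 + v)"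
    using Suc.prems(3) by auto
  define x where "x = 1 / (1 + real v)"
  have x: "x \<in> {0<..1}" by (simp add: x_def)
  have "x / (x + 2 ^ Suc l) = 1 / (1 + real w)"
    unfolding w x_def by (simp add: field_simps add_pos_pos)
  then have "0 < B2 h x"
    using Suc.prems by (intro B2_pos[of h x l] x) auto
  then have "0 < (B2 ^^ n) (B2 h) 1"
    using Suc.prems v x_def by (intro Suc.IH[of "B2 h" v] admissible_B2 B2_nonneg) auto
  then show ?case by (simp add: funpow_Suc_right del: funpow.simps)
qed

text \<open>
  Splitting off the power of two from \<open>w > 0\<close> leaves an odd number \<open>1 + v\<close> with \<open>v\<close> even and
  smaller; this removes the lowest binary digit equal to one.
\<close>
lemma even_in_unit_preimages: "even w \<Longrightarrow> \<exists>n. w \<in> unit_preimages n"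
proof (induction w rule: less_induct)
  case (less w)
  show ?case
  proof (cases "w = 0")
    case True
    then have "w \<in> unit_preimages 0" by simp
    then show ?thesis by blast
  next
    case False
    define m where "m = multiplicity 2 w"
    obtain c where c: "w = 2 ^ m * c" "odd c"
      using multiplicity_decompose'[of w 2] False by (auto simp: m_def)
    then have "m \<noteq> 0" using less.prems by (metis mult_1 power_0)
    then obtain l where l: "m = Suc l" by (cases m) auto
    from \<open>odd c\<close> obtain v where v: "c = Suc v" "even v" by (cases c) auto
    have "1 * c \<le> 2 ^ m * c" by (rule mult_right_mono) auto
    then have "v < w" using c v by simp
    then obtain n where "v \<in> unit_preimages n" using less.IH v by blast
    then have "w \<in> unit_preimages (Suc n)" using c l v by auto
    then show ?thesis by blast
  qed
qed

text \<open>
  One more binary digit, placed far below the others, moves the number \<open>(1 + w) / 2 ^ k\<close> by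
  arbitrarily little. This allows an arbitrary increase of the number of digits.
\<close>
lemma unit_preimages_shift:
  assumes "w \<in> unit_preimages n" "a < (1 + real w) / 2 ^ Suc k" "(1 + real w) / 2 ^ Suc k < b"
  shows "\<exists>w'\<in>unit_preimages (Suc n). \<exists>k'. a < (1 + real w') / 2 ^ Suc k' \<and> (1 + real w') / 2 ^ Suc k' < b"
proof -
  define u where "u = (1 + real w) / 2 ^ Suc k"
  obtain l where l: "(1/2) ^ l < b - u"
    using real_arch_pow_inv[of "b - u" "1/2"] assms by (auto simp: u_def)
  define w' where "w' = 2 ^ Suc l * (1 + w)"
  have w': "w' \<in> unit_preimages (Suc n)" using assms(1) by (auto simp: w'_def)
  have eq: "(1 + real w') / 2 ^ Suc (k + Suc l) = (1/2) ^ Suc (k + Suc l) + u"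
    by (simp add: w'_def u_def power_add power_one_over field_simps)
  have "(1/2::real) ^ Suc (k + Suc l) \<le> (1/2) ^ l" by (rule power_decreasing) auto
  then have "(1 + real w') / 2 ^ Suc (k + Suc l) < b" using l unfolding eq by linarith
  moreover have "a < (1 + real w') / 2 ^ Suc (k + Suc l)"
    using assms(2) unfolding eq u_def[symmetric] by (simp add: add_pos_pos less_trans)
  ultimately show ?thesis using w' by blast
qed

text \<open>
  The numbers \<open>(1 + w) / 2 ^ k\<close> with even \<open>w\<close> and \<open>k \<ge> 1\<close> are the positive dyadic rationals that are not
  integers, and these are dense; the number of digits of one that is close to \<open>u\<close> is raised by
  \<open>unit_preimages_shift\<close>.
\<close>
lemma unit_preimages_dense:
  assumes "0 < u" "0 < e"
  shows "\<exists>N. \<forall>n\<ge>N. \<exists>w\<in>unit_preimages n. \<exists>k. u - e < (1 + real w) / 2 ^ Suc k \<and> (1 + real w) / 2 ^ Suc k < u + e"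
proof -
  obtain k where k: "1 / e < 2 ^ k" using real_arch_pow[of 2 "1 / e"] by auto
  define K where "K = (2::real) ^ Suc k"
  have K: "K > 0" "1 < e * K" 
  proof -
    show "K > 0" by (simp add: K_def)
    have "1 < e * 2 ^ k" using k assms by (simp add: field_simps)
    also have "\<dots> \<le> e * K" using assms by (simp add: K_def)
    finally show "1 < e * K" .
  qed
  \<comment> \<open>\<open>1 + w\<close> is the odd number closest to \<open>K * u\<close>, up to ties\<close>
  define w where "w = 2 * nat \<lfloor>K * u / 2\<rfloor>"
  have "0 \<le> \<lfloor>K * u / 2\<rfloor>" using K assms by simp
  then have rw: "real w = 2 * of_int \<lfloor>K * u / 2\<rfloor>" by (simp add: w_def)
  have "\<bar>(1 + real w) - K * u\<bar> \<le> 1" unfolding rw by linarith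
  also note \<open>1 < e * K\<close>
  finally have "\<bar>(1 + real w) / K - u\<bar> < e"
    using K(1) by (simp add: abs_less_iff field_simps)
  then have w: "u - e < (1 + real w) / 2 ^ Suc k" "(1 + real w) / 2 ^ Suc k < u + e"
    unfolding K_def abs_less_iff by linarith+
  obtain N where "w \<in> unit_preimages N" using even_in_unit_preimages[of w] by (auto simp: w_def)
  then have start: "\<exists>w\<in>unit_preimages N. \<exists>k. u - e < (1 + real w) / 2 ^ Suc k \<and> (1 + real w) / 2 ^ Suc k < u + e"
    using w by blast
  have "\<exists>w\<in>unit_preimages n. \<exists>k. u - e < (1 + real w) / 2 ^ Suc k \<and> (1 + real w) / 2 ^ Suc k < u + e"
    if "n \<ge> N" for n
    using that
  proof (induction n rule: dec_induct)
    case base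
    show ?case by (rule start)
  next
    case (step n)
    then show ?case using unit_preimages_shift by blast
  qed
  then show ?thesis by blast
qed

text \<open>
  Mass anywhere reaches the point \<open>1\<close> after any sufficiently large number of steps. Along a path of
  branches from \<open>1\<close>, the branches \<open>x / (x + 2 ^ k)\<close> come first and a single \<open>1 / (1 + 2 ^ k * x)\<close> last; the
  latter sends \<open>x = 1 / (1 + w)\<close> to \<open>u / (1 + u)\<close> with \<open>u = (1 + w) / 2 ^ k\<close>, and such \<open>u\<close> are dense.
\<close>
lemma B2_eventually_pos_at_1:
  assumes h: "admissible h" and nn: "\<And>y. y \<in> {0<..1} \<Longrightarrow> 0 \<le> h y"
    and a: "a \<in> {0<..<1}" "0 < h a"
  shows "\<forall>\<^sub>F n in sequentially. 0 < (B2 ^^ n) h 1"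
proof -
  \<comment> \<open>inverts \<open>a = u / (1 + u)\<close>\<close>
  define u where "u = a / (1 - a)"
  have u: "u > 0" "u / (1 + u) = a" using a by (auto simp: u_def field_simps)
  have "continuous_on {0<..<1} h"
    using h by (auto simp: admissible_def intro: continuous_on_subset)
  then have "isCont h (u / (1 + u))"
    using a u by (simp add: continuous_on_eq_continuous_at)
  moreover have "isCont (\<lambda>t. t / (1 + t)) u"
    using u by (intro continuous_intros) auto
  ultimately have "isCont (\<lambda>t. h (t / (1 + t))) u"
    by (intro isCont_o2[where f = "\<lambda>t. t / (1 + t)" and g = h])
  then have "((\<lambda>t. h (t / (1 + t))) \<longlongrightarrow> h a) (at u)"
    by (simp add: isCont_def u)
  then have "\<forall>\<^sub>F t in at u. 0 < h (t / (1 + t))"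
    using a(2) by (rule order_tendstoD)
  then obtain e where e0: "e > 0" "\<And>t. t \<noteq> u \<Longrightarrow> \<bar>t - u\<bar> < e \<Longrightarrow> 0 < h (t / (1 + t))"
    by (auto simp: eventually_at dist_real_def)
  then have e: "e > 0" "\<And>t. \<bar>t - u\<bar> < e \<Longrightarrow> 0 < h (t / (1 + t))"
    using a(2) u(2) by metis+
  obtain N where N: "\<And>n. n \<ge> N \<Longrightarrow> \<exists>w\<in>unit_preimages n. \<exists>k. u - e < (1 + real w) / 2 ^ Suc k \<and> (1 + real w) / 2 ^ Suc k < u + e"
    using unit_preimages_dense[OF u(1) e(1)] by blast
  have "0 < (B2 ^^ Suc n) h 1" if n: "n \<ge> N" for n
  proof -
    obtain w k where w: "w \<in> unit_preimages n" "u - e < (1 + real w) / 2 ^ Suc k" "(1 + real w) / 2 ^ Suc k < u + e"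
      using N[OF n] by blast
    then have close: "\<bar>(1 + real w) / 2 ^ Suc k - u\<bar> < e"
      unfolding abs_less_iff by linarith
    define x where "x = 1 / (1 + real w)"
    have x: "x \<in> {0<..1}" by (simp add: x_def)
    have "1 / (1 + 2 ^ Suc k * x) = ((1 + real w) / 2 ^ Suc k) / (1 + (1 + real w) / 2 ^ Suc k)"
    proof -
      have "1 / (1 + K * (1 / c)) = (c / K) / (1 + c / K)" if "K > 0" "c > 0" for K c :: real
        using that by (simp add: divide_simps add_pos_pos)
      then show ?thesis unfolding x_def by simp
    qed
    then have "0 < B2 h x"
      using e(2)[OF close] by (intro B2_pos[of h x k] h nn x) auto
    then have "0 < (B2 ^^ n) (B2 h) 1"
      using w(1) x_def by (intro B2_iter_pos_at_1[of "B2 h" w] admissible_B2 B2_nonneg h nn) auto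
    then show ?thesis by (simp add: funpow_Suc_right del: funpow.simps)
  qed
  then have "\<forall>\<^sub>F n in sequentially. 0 < (B2 ^^ Suc n) h 1"
    by (auto simp: eventually_sequentially)
  then show ?thesis by (rule eventually_sequentially_Suc[THEN iffD1])
qed

text \<open>
  If the norm never drops, then \<open>B2\<close> acts on \<open>d\<close> without cancellation: the iterates of
  \<open>\<bar>d\<bar>\<close> and of \<open>d\<close> agree up to sign at the point \<open>1\<close>. If \<open>d\<close> took both signs, then the iterates of \<open>\<bar>d\<bar> + d\<close> and
  \<open>\<bar>d\<bar> - d\<close> would both become positive there.
\<close>
lemma B2_rigid:
  assumes d: "admissible d" and 0: "(LINT x|lebesgue_on {0..1}. d x) = 0"
    and norm: "\<And>n. (LINT x|lebesgue_on {0..1}. \<bar>(B2 ^^ n) d x\<bar>) = (LINT x|lebesgue_on {0..1}. \<bar>d x\<bar>)"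
    and x: "x \<in> {0<..1}"
  shows "d x = 0"
proof -
  let ?a = "\<lambda>y. \<bar>d y\<bar>"
  have ad: "admissible ?a" by (rule admissible_abs[OF d])
  have eq: "\<bar>(B2 ^^ n) d 1\<bar> = (B2 ^^ n) ?a 1" for n
  proof -
    let ?h = "\<lambda>y. (B2 ^^ n) ?a y - \<bar>(B2 ^^ n) d y\<bar>"
    have L: "L1 ((B2 ^^ n) ?a)" "L1 (\<lambda>y. \<bar>(B2 ^^ n) d y\<bar>)"
      by (intro admissible_imp_L1 admissible_abs admissible_B2_iter d)+
    have "?h 1 = 0"
    proof (rule admissible_nonneg_integral_0[where h = ?h])
      show "admissible ?h"
        by (intro admissible_diff admissible_abs admissible_B2_iter d)
      show "0 \<le> ?h y" if "y \<in> {0<..<1}" for y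
        using abs_B2_iter_le[OF d, of y n] that by auto
      show "(LINT x|lebesgue_on {0..1}. ?h x) = 0"
        using norm[of n] B2_iter_preserves_integral[OF ad, of n] Bochner_Integration.integral_diff[OF L] by simp
    qed simp
    then show ?thesis by simp
  qed
  have one_sign: False if pos: "a \<in> {0<..<1}" "0 < d a" and neg: "b \<in> {0<..<1}" "d b < 0" for a b
  proof -
    have "\<forall>\<^sub>F n in sequentially. 0 < (B2 ^^ n) (\<lambda>y. ?a y + d y) 1"
      by (rule B2_eventually_pos_at_1[of _ a]) (use pos in \<open>auto intro: admissible_add ad d\<close>)
    moreover have "\<forall>\<^sub>F n in sequentially. 0 < (B2 ^^ n) (\<lambda>y. ?a y + - d y) 1"
      by (rule B2_eventually_pos_at_1[of _ b])
         (use neg in \<open>auto intro!: admissible_add[OF ad admissible_uminus[OF d], simplified]\<close>)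
    ultimately have "\<forall>\<^sub>F n in sequentially. False"
    proof eventually_elim
      case (elim n)
      then show False
        using eq[of n] B2_iter_add[OF ad d, of 1 n] B2_iter_add[OF ad admissible_uminus[OF d], of 1 n]
          B2_iter_uminus[OF d, of 1 n] by auto
    qed
    then show False by simp
  qed
  show ?thesis
  proof (cases "\<forall>y\<in>{0<..<1}. 0 \<le> d y")
    case True
    then show ?thesis by (intro admissible_nonneg_integral_0[OF d _ 0 x]) auto
  next
    case False
    then have "0 \<le> - d y" if "y \<in> {0<..<1}" for y
      using one_sign that by (meson neg_0_le_iff_le not_le)
    then have "- d x = 0"
      by (intro admissible_nonneg_integral_0[OF admissible_uminus[OF d] _ _ x]) (use 0 in auto)
    then show ?thesis by simp
  qed
qed

section \<open>Limits\<close>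

lemma B2_tendsto:
  assumes dom: "\<And>n. sqrt_dominated C (u n)"
    and lim: "\<And>y. y \<in> {0<..1} \<Longrightarrow> (\<lambda>n. u n y) \<longlonglongrightarrow> f y" and x: "x \<in> {0<..1}"
  shows "(\<lambda>n. B2 (u n) x) \<longlonglongrightarrow> B2 f x"
proof -
  have terms: "(\<lambda>n. B2_term (u n) (Suc k) x) \<longlonglongrightarrow> B2_term f (Suc k) x" for k
    unfolding B2_term_def by (intro tendsto_intros lim branch_in_unit x)
  have "norm (B2_term (u n) (Suc k) x) \<le> C / sqrt x * (1 / sqrt 2) ^ Suc k" for n k
    using B2_term_bound[OF dom x] by (simp only: real_norm_def)
  then have bound: "\<forall>\<^sub>F (k, n) in at_top \<times>\<^sub>F sequentially.
      norm (B2_term (u n) (Suc k) x) \<le> C / sqrt x * (1 / sqrt 2) ^ Suc k"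
    by (intro always_eventually) (simp only: split_paired_all case_prod_conv, blast)
  show ?thesis
    unfolding B2_def
    using tannerys_theorem[OF terms bound summable_B2_bound sequentially_bot] by blast
qed

lemma B2_iter_tendsto:
  assumes dom: "\<And>n. sqrt_dominated C (u n)"
    and lim: "\<And>y. y \<in> {0<..1} \<Longrightarrow> (\<lambda>n. u n y) \<longlonglongrightarrow> f y" and x: "x \<in> {0<..1}"
  shows "(\<lambda>n. (B2 ^^ m) (u n) x) \<longlonglongrightarrow> (B2 ^^ m) f x"
  using x
proof (induction m arbitrary: x)
  case (Suc m)
  show ?case
    using B2_tendsto[OF sqrt_dominated_B2_iter[OF dom] Suc.IH Suc.prems] by simp
qed (simp add: lim)

text \<open>
  Dominated convergence with the integrable majorant \<open>C / sqrt x\<close>.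
\<close>
lemma integral_abs_tendsto:
  assumes u: "\<And>n. admissible (u n)" "\<And>n. sqrt_dominated C (u n)" and f: "admissible f"
    and lim: "\<And>x. x \<in> {0<..1} \<Longrightarrow> (\<lambda>n. u n x) \<longlonglongrightarrow> f x"
  shows "(\<lambda>n. LINT x|lebesgue_on {0..1}. \<bar>u n x\<bar>) \<longlonglongrightarrow> (LINT x|lebesgue_on {0..1}. \<bar>f x\<bar>)"
proof (rule integral_dominated_convergence[where w = "\<lambda>x. C / sqrt x"])
  have "C \<ge> 0" using u(2) by (rule sqrt_dominated_nonneg)
  then have "admissible (\<lambda>x. C / sqrt x)"
    unfolding admissible_def sqrt_dominated_def
    by (intro conjI exI[of _ C] continuous_intros) auto
  then show "L1 (\<lambda>x. C / sqrt x)" by (rule admissible_imp_L1)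
  show "(\<lambda>x. \<bar>f x\<bar>) \<in> borel_measurable (lebesgue_on {0..1})"
    by (intro borel_measurable_integrable admissible_imp_L1 admissible_abs f)
  show "(\<lambda>x. \<bar>u n x\<bar>) \<in> borel_measurable (lebesgue_on {0..1})" for n
    by (intro borel_measurable_integrable admissible_imp_L1 admissible_abs u)
  show "AE x in lebesgue_on {0..1}. (\<lambda>n. \<bar>u n x\<bar>) \<longlonglongrightarrow> \<bar>f x\<bar>"
    by (intro AE_unit_interval tendsto_rabs lim) auto
  show "AE x in lebesgue_on {0..1}. norm \<bar>u n x\<bar> \<le> C / sqrt x" for n
    by (intro AE_unit_interval) (use u(2)[of n] in \<open>auto simp: sqrt_dominated_def\<close>)
qed

text \<open>
  The norm of \<open>f\<^sub>n\<^sub>+\<^sub>1 - f\<^sub>n\<close> is a Lyapunov function: it decreases along the orbit, hence is constant along the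
  orbit of any limit point, and \<open>B2_rigid\<close> applies to \<open>d = B2 f - f\<close>.
\<close>
lemma subsequential_limit_fixed:
  assumes r: "strict_mono (r :: nat \<Rightarrow> nat)" and f: "admissible f"
    and lim: "\<And>x. x \<in> {0<..1} \<Longrightarrow> (\<lambda>n. g_density (r n) x) \<longlonglongrightarrow> f x" and x: "x \<in> {0<..1}"
  shows "B2 f x = f x"
proof -
  define v where "v = (\<lambda>n x. g_density (Suc n) x - g_density n x)"
  define \<delta> where "\<delta> = (\<lambda>n. LINT x|lebesgue_on {0..1}. \<bar>v n x\<bar>)"
  define d where "d = (\<lambda>x. B2 f x - f x)"
  have v: "admissible (v n)" "sqrt_dominated 8 (v n)" for n
    using admissible_diff[OF admissible_g_density admissible_g_density, of "Suc n" n]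
      sqrt_dominated_diff[of 4 "g_density (Suc n)" 4 "g_density n"] g_density_tame by (auto simp: v_def)
  have d: "admissible d"
    unfolding d_def by (intro admissible_diff admissible_B2 f)
  have v_iter: "(B2 ^^ m) (v n) x = v (n + m) x" if "x \<in> {0<..1}" for n m x
    unfolding v_def using B2_iter_diff[OF admissible_g_density admissible_g_density that, of m "Suc n" n]
    by (simp add: g_density_add[symmetric])
  have \<delta>_iter: "(LINT x|lebesgue_on {0..1}. \<bar>(B2 ^^ m) (v n) x\<bar>) = \<delta> (n + m)" for n m
    unfolding \<delta>_def
    by (intro L1_integral_cong admissible_imp_L1 admissible_abs admissible_B2_iter v) (simp add: v_iter)
  have "\<delta> (Suc n) \<le> \<delta> n" for n
    using B2_L1_contraction[OF v(1), of n] \<delta>_iter[of 1 n] by (simp add: \<delta>_def)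
  then have "decseq \<delta>" by (rule decseq_SucI)
  moreover have "0 \<le> \<delta> n" for n by (simp add: \<delta>_def)
  ultimately obtain L where L: "\<delta> \<longlonglongrightarrow> L"
    using decseq_convergent by metis
  have lim_d: "(\<lambda>n. v (r n) x) \<longlonglongrightarrow> d x" if "x \<in> {0<..1}" for x
    unfolding v_def d_def g_density_Suc
    by (intro tendsto_diff lim that B2_tendsto[where C = 4]) (simp_all add: g_density_tame)
  have norm_L: "(LINT x|lebesgue_on {0..1}. \<bar>(B2 ^^ m) d x\<bar>) = L" for m
  proof (rule LIMSEQ_unique)
    show "(\<lambda>n. LINT x|lebesgue_on {0..1}. \<bar>(B2 ^^ m) (v (r n)) x\<bar>)
        \<longlonglongrightarrow> (LINT x|lebesgue_on {0..1}. \<bar>(B2 ^^ m) d x\<bar>)"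
      by (intro integral_abs_tendsto[where C = "(1 + sqrt 2) ^ m * 8"] admissible_B2_iter
            sqrt_dominated_B2_iter v d B2_iter_tendsto[where C = 8] lim_d)
    have "filterlim (\<lambda>n. r n + m) sequentially sequentially"
      by (intro filterlim_subseq strict_monoI) (use r in \<open>simp add: strict_mono_def\<close>)
    then show "(\<lambda>n. LINT x|lebesgue_on {0..1}. \<bar>(B2 ^^ m) (v (r n)) x\<bar>) \<longlonglongrightarrow> L"
      unfolding \<delta>_iter by (rule filterlim_compose[OF L])
  qed
  have "(LINT x|lebesgue_on {0..1}. d x) = 0"
    unfolding d_def
    by (subst Bochner_Integration.integral_diff)
       (simp_all add: admissible_imp_L1 admissible_B2 f B2_preserves_integral)
  then have "d x = 0"
    by (rule B2_rigid[OF d _ _ x]) (use norm_L norm_L[of 0] in simp)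
  then show ?thesis by (simp add: d_def)
qed

text \<open>
  The distance to a fixed point decreases, so convergence along one subsequence implies \<open>L\<^sup>1\<close>
  convergence. If it failed at a point, compactness would provide another subsequential limit; it
  has \<open>L\<^sup>1\<close> distance zero from the first and, both being continuous, agrees with it everywhere.
\<close>
lemma g_density_converges:
  obtains f where "admissible f" "\<And>x. x \<in> {0<..1} \<Longrightarrow> B2 f x = f x"
    "\<And>x. x \<in> {0<..1} \<Longrightarrow> (\<lambda>n. g_density n x) \<longlonglongrightarrow> f x"
    "(\<lambda>n. LINT x|lebesgue_on {0..1}. \<bar>g_density n x - f x\<bar>) \<longlonglongrightarrow> 0"
proof -
  note dt = g_density_tame[THEN conjunct1] g_density_tame[THEN conjunct2]
  obtain f r where r: "strict_mono (r :: nat \<Rightarrow> nat)" and f: "admissible f"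
    and lim: "\<And>x. x \<in> {0<..1} \<Longrightarrow> (\<lambda>n. g_density (r n) x) \<longlonglongrightarrow> f x"
    by (rule tame_subsequence[of g_density, OF dt]) (rule that)
  have fix_f: "B2 f x = f x" if "x \<in> {0<..1}" for x
    by (rule subsequential_limit_fixed[OF r f lim that])
  obtain C where C: "sqrt_dominated C f" using f by (auto simp: admissible_def)
  define e where "e = (\<lambda>n. LINT x|lebesgue_on {0..1}. \<bar>g_density n x - f x\<bar>)"
  have diff: "admissible (\<lambda>x. g_density n x - f x)" "sqrt_dominated (4 + C) (\<lambda>x. g_density n x - f x)" for n
    by (intro admissible_diff admissible_g_density f sqrt_dominated_diff dt C)+
  have lim_e: "(\<lambda>n. e (s n)) \<longlonglongrightarrow> (LINT x|lebesgue_on {0..1}. \<bar>f' x - f x\<bar>)"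
    if "admissible f'" "\<And>x. x \<in> {0<..1} \<Longrightarrow> (\<lambda>n. g_density (s n) x) \<longlonglongrightarrow> f' x" for s f'
    unfolding e_def
    by (intro integral_abs_tendsto[where C = "4 + C"] diff admissible_diff f that tendsto_diff tendsto_const)
  have "e (Suc n) \<le> e n" for n
  proof -
    have "e (Suc n) = (LINT x|lebesgue_on {0..1}. \<bar>B2 (\<lambda>x. g_density n x - f x) x\<bar>)"
      unfolding e_def
      by (intro L1_integral_cong admissible_imp_L1 admissible_abs diff admissible_B2)
         (simp add: B2_diff admissible_g_density f fix_f g_density_Suc)
    then show ?thesis using B2_L1_contraction[OF diff(1), of n] by (simp add: e_def)
  qed
  then have "decseq e" by (rule decseq_SucI)
  moreover have "0 \<le> e n" for n by (simp add: e_def)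
  ultimately obtain l where l: "e \<longlonglongrightarrow> l"
    using decseq_convergent by metis
  have "(\<lambda>n. e (r n)) \<longlonglongrightarrow> 0" using lim_e[OF f lim] by simp
  then have "l = 0"
    using LIMSEQ_unique LIMSEQ_subseq_LIMSEQ[OF l r] by (auto simp: comp_def)
  with l have e0: "e \<longlonglongrightarrow> 0" by simp
  have conv: "(\<lambda>n. g_density n x) \<longlonglongrightarrow> f x" if x: "x \<in> {0<..1}" for x
  proof (rule ccontr)
    assume "\<not> ?thesis"
    then obtain \<epsilon> where \<epsilon>: "\<epsilon> > 0" "\<not> (\<forall>\<^sub>F n in sequentially. \<bar>g_density n x - f x\<bar> < \<epsilon>)"
      by (auto simp: tendsto_iff dist_real_def)
    then have "infinite {n. \<epsilon> \<le> \<bar>g_density n x - f x\<bar>}"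
      by (auto simp: infinite_nat_iff_unbounded_le eventually_sequentially not_less)
    then obtain s where s: "strict_mono (s :: nat \<Rightarrow> nat)" "\<And>n. \<epsilon> \<le> \<bar>g_density (s n) x - f x\<bar>"
      using infinite_enumerate by blast
    obtain f' t where t: "strict_mono (t :: nat \<Rightarrow> nat)" and f': "admissible f'"
      and lim': "\<And>x. x \<in> {0<..1} \<Longrightarrow> (\<lambda>n. g_density (s (t n)) x) \<longlonglongrightarrow> f' x"
      by (rule tame_subsequence[of "\<lambda>n. g_density (s n)", OF dt]) (rule that)
    have "(\<lambda>n. e (s (t n))) \<longlonglongrightarrow> 0"
      using LIMSEQ_subseq_LIMSEQ[OF e0 strict_mono_o[OF s(1) t]] by (simp add: comp_def)
    then have 0: "(LINT x|lebesgue_on {0..1}. \<bar>f' x - f x\<bar>) = 0"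
      using lim_e[OF f' lim'] LIMSEQ_unique by blast
    have "\<bar>f' x - f x\<bar> = 0"
      by (rule admissible_nonneg_integral_0[OF admissible_abs[OF admissible_diff[OF f' f]] _ 0 x]) simp
    then have "(\<lambda>n. \<bar>g_density (s (t n)) x - f x\<bar>) \<longlonglongrightarrow> 0"
      using tendsto_rabs[OF tendsto_diff[OF lim'[OF x] tendsto_const[of "f x"]]] by simp
    then have "\<epsilon> \<le> 0" by (rule LIMSEQ_le_const) (use s(2) in auto)
    then show False using \<epsilon>(1) by simp
  qed
  show ?thesis
    by (rule that[OF f fix_f conv e0[unfolded e_def]])
qed

theorem theorem4p3:
  shows "\<exists>ginf :: real \<Rightarrow> real.
    accumulation_point_C g ginf \<and>
    (\<forall>l. accumulation_point_C g l \<longrightarrow> (\<forall>x\<in>{0..1}. l x = ginf x)) \<and>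
    uniform_limit {0..1} g ginf sequentially \<and>
    (\<forall>x\<in>{0..1}. F ginf x = ginf x) \<and>
    (AE x in lebesgue_on {0..1}. (\<forall>n. g n differentiable at x) \<and> ginf differentiable at x) \<and>
    (AE x in lebesgue_on {0..1}. (\<lambda>n. deriv (g n) x) \<longlonglongrightarrow> deriv ginf x) \<and>
    tendsto_L1 (\<lambda>n. deriv (g n)) (deriv ginf) \<and>
    (AE x in lebesgue_on {0..1}. B2 (deriv ginf) x = deriv ginf x)"
proof -
  obtain f where f: "admissible f" and fix_f: "\<And>x. x \<in> {0<..1} \<Longrightarrow> B2 f x = f x"
    and lim: "\<And>x. x \<in> {0<..1} \<Longrightarrow> (\<lambda>n. g_density n x) \<longlonglongrightarrow> f x"
    and lim_L1: "(\<lambda>n. LINT x|lebesgue_on {0..1}. \<bar>g_density n x - f x\<bar>) \<longlonglongrightarrow> 0"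
    using g_density_converges by blast
  define ginf where "ginf = (\<lambda>x. 1 - integral {0..x} f)"
  note prim = admissible_has_primitive[OF f]
  have cont: "continuous_on {0..1} ginf"
    unfolding ginf_def by (intro continuous_intros prim)
  have der: "(ginf has_field_derivative - f x) (at x)" if "x \<in> {0<..<1}" for x
    unfolding ginf_def using prim(2)[OF that] by (auto intro!: derivative_eq_intros)
  have deriv_ginf: "deriv ginf x = - f x" and deriv_g: "deriv (g n) x = - g_density n x"
    if "x \<in> {0<..<1}" for x n
    using der[OF that] g_has_derivative[OF that] by (auto intro: DERIV_imp_deriv)
  have bound: "\<bar>g n x - ginf x\<bar> \<le> (LINT x|lebesgue_on {0..1}. \<bar>g_density n x - f x\<bar>)"
    if "x \<in> {0..1}" for n x
  proof -
    have "\<bar>(\<lambda>x. g n x - ginf x) x - (\<lambda>x. g n x - ginf x) 0\<bar>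
        \<le> (LINT x|lebesgue_on {0..1}. \<bar>- g_density n x - - f x\<bar>)"
    proof (rule abs_le_integral_abs_deriv)
      show "L1 (\<lambda>x. - g_density n x - - f x)"
        by (intro admissible_imp_L1 admissible_diff admissible_uminus admissible_g_density f)
      show "continuous_on {0..1} (\<lambda>x. g n x - ginf x)"
        by (intro continuous_on_diff continuous_on_g cont)
      show "((\<lambda>x. g n x - ginf x) has_field_derivative - g_density n y - - f y) (at y)" if "y \<in> {0<..<1}" for y
        by (intro DERIV_diff der g_has_derivative that)
      show "x \<in> {0..1}" by (rule that)
    qed
    then show ?thesis by (simp add: g_at_0 ginf_def abs_minus_commute)
  qed
  have ul: "uniform_limit {0..1} g ginf sequentially"
  proof (rule uniform_limitI)
    fix e :: real assume "e > 0"
    then have "\<forall>\<^sub>F n in sequentially. (LINT x|lebesgue_on {0..1}. \<bar>g_density n x - f x\<bar>) < e"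
      using lim_L1 by (auto intro: order_tendstoD)
    then show "\<forall>\<^sub>F n in sequentially. \<forall>x\<in>{0..1}. dist (g n x) (ginf x) < e"
      by eventually_elim (auto simp: dist_real_def intro: le_less_trans[OF bound])
  qed
  have acc: "accumulation_point_C g ginf"
    unfolding accumulation_point_C_def using cont ul by (auto intro!: exI[of _ id] strict_mono_id)
  have uniq: "l x = ginf x" if l: "accumulation_point_C g l" and x: "x \<in> {0..1}" for l x
  proof -
    obtain r where r: "strict_mono r" "uniform_limit {0..1} (\<lambda>n. g (r n)) l sequentially"
      using l by (auto simp: accumulation_point_C_def)
    have "(\<lambda>n. g (r n) x) \<longlonglongrightarrow> ginf x"
      using LIMSEQ_subseq_LIMSEQ[OF tendsto_uniform_limitI[OF ul x] r(1)] by (simp add: comp_def)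
    then show ?thesis using tendsto_uniform_limitI[OF r(2) x] LIMSEQ_unique by blast
  qed
  have fixed: "F ginf x = ginf x" if x: "x \<in> {0..1}" for x
  proof -
    have "(\<lambda>n. g n 1) \<longlonglongrightarrow> ginf 1" using tendsto_uniform_limitI[OF ul, of 1] by simp
    then have g1: "ginf 1 = 0" by (simp add: g_at_1 LIMSEQ_const_iff)
    obtain C where C: "sqrt_dominated C (\<lambda>x. - f x)"
      using admissible_uminus[OF f] by (auto simp: admissible_def)
    have d0: "((\<lambda>x. F ginf x - ginf x) has_field_derivative 0) (at y)" if y: "0 < y" "y < 1" for y
    proof -
      have "B2 (\<lambda>x. - f x) y = - f y" using B2_uminus[OF f, of y] fix_f[of y] y by simp
      then show ?thesis
        using DERIV_diff[OF F_has_derivative[OF cont der C, of y] der[of y]] y by simp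
    qed
    have c0: "continuous_on {0..1} (\<lambda>x. F ginf x - ginf x)"
      by (intro continuous_intros F_uniform_limit cont)
    have const: "F ginf t - ginf t = F ginf 0 - ginf 0" if "t \<in> {0..1}" for t
      using DERIV_isconst2[OF _ c0 d0, of t] that by auto
    show ?thesis using const[OF x] const[of 1] g1 F_at_1[of ginf] by simp
  qed
  have AE_diff: "AE x in lebesgue_on {0..1}. (\<forall>n. g n differentiable at x) \<and> ginf differentiable at x"
    by (rule AE_unit_interval) (use der g_has_derivative real_differentiable_def in blast)
  have AE_lim: "AE x in lebesgue_on {0..1}. (\<lambda>n. deriv (g n) x) \<longlonglongrightarrow> deriv ginf x"
    by (rule AE_unit_interval) (auto simp: deriv_ginf deriv_g intro!: tendsto_minus lim)
  have L1: "L1 (deriv (g n))" "L1 (deriv ginf)" for n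
    using L1_cong[OF admissible_imp_L1[OF admissible_uminus[OF admissible_g_density]] deriv_g]
      L1_cong[OF admissible_imp_L1[OF admissible_uminus[OF f]] deriv_ginf] by auto
  have "(LINT x|lebesgue_on {0..1}. \<bar>deriv (g n) x - deriv ginf x\<bar>)
      = (LINT x|lebesgue_on {0..1}. \<bar>g_density n x - f x\<bar>)" for n
    by (intro L1_integral_cong integrable_abs Bochner_Integration.integrable_diff L1
          admissible_imp_L1 admissible_g_density f) (auto simp: deriv_g deriv_ginf)
  then have tL1: "tendsto_L1 (\<lambda>n. deriv (g n)) (deriv ginf)"
    unfolding tendsto_L1_def using L1 lim_L1 by simp
  have AE_fix: "AE x in lebesgue_on {0..1}. B2 (deriv ginf) x = deriv ginf x"
  proof (rule AE_unit_interval)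
    fix x :: real assume x: "x \<in> {0<..<1}"
    have "B2 (deriv ginf) x = B2 (\<lambda>x. - f x) x"
      by (rule B2_cong) (use x deriv_ginf in auto)
    then show "B2 (deriv ginf) x = deriv ginf x"
      using B2_uminus[OF f, of x] fix_f[of x] deriv_ginf[OF x] x by simp
  qed
  show ?thesis
    using acc uniq ul fixed AE_diff AE_lim tL1 AE_fix by blast
qed

end
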